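(* For integers $m\ge2$ and $n\ge0$, let \[ M_{m,n}:=\int\cdots\int_{W_m}\frac{(-\ln(x_1\cdots x_m))^n}{x_1\cdots x_m}\,dx_1\cdots dx_m . \] Set $A(k_2):=\frac{1}{k_2!}$ and, for $m\ge3$, \[ A(k_2,\dots,k_m):=\frac{1}{k_2!\cdots k_m!}\cdot\frac{1}{(k_m+1)(k_{m-1}+k_m+2)\cdots(k_3+\cdots+k_m+m-2)}. \] Writing $S:=k_2+\cdots+k_m+m-2$, we have \[ M_{m,n}=m!\,n!\sum_{\substack{k_1,\dots,k_m\ge0\\ k_1+\cdots+k_m=n}}A(k_2,\dots,k_m)\Bigl[S!\,\zeta(S+2,\{1\}_{k_1})-\frac{\ln^{m+n}2}{(k_1+1)!\,(m+n)}-S!\sum_{p=0}^{S}\frac{\ln^p2}{p!}\operatorname{Li}_{S+2-p,\{1\}_{k_1}}\!\left(\tfrac12\right)\Bigr]. \] In particular, $M_{m,n}$ is a polynomial with rational coefficients in $\ln2$, the values $\zeta(a,\{1\}_{m+n-a})$ with $m\le a\le m+n$, and the values $\operatorname{Li}_{b,\{1\}_c}(1/2)$ with $b\ge2$, $0\le c\le n$, $b+c\le m+n$.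
   Context: $W_m:=\{(x_1,\dots,x_m)\in[0,1]^m : x_i+x_j\ge1 \text{ for all } 1\le i<j\le m\}$. Multiple zeta values: $\zeta(s_1,\dots,s_l):=\sum_{n_1>\cdots>n_l>0}n_1^{-s_1}\cdots n_l^{-s_l}$ ($s_1\ge2$). Multiple polylogarithm: $\operatorname{Li}_{s_1,\dots,s_l}(z):=\sum_{n_1>n_2>\cdots>n_l>0}\frac{z^{n_1}}{n_1^{s_1}\cdots n_l^{s_l}}$. The notation $\{1\}_k$ denotes the string $1,1,\dots,1$ ($k$ times); for $k=0$ it is empty. *)

theory Defs
  imports "HOL-Analysis.Analysis"
begin

definition W :: "nat \<Rightarrow> (nat \<Rightarrow> real) set" where
  "W m = {x. (\<forall>i\<in>{1..m}. 0 \<le> x i \<and> x i \<le> 1) \<and>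
             (\<forall>i\<in>{1..m}. \<forall>j\<in>{1..m}. i < j \<longrightarrow> 1 \<le> x i + x j)}"

definition M :: "nat \<Rightarrow> nat \<Rightarrow> ennreal" where
  "M m n = (\<integral>\<^sup>+ x. indicator (W m) x *
      ennreal ((- ln (\<Prod>i\<in>{1..m}. x i)) ^ n / (\<Prod>i\<in>{1..m}. x i))
      \<partial>(PiM {1..m} (\<lambda>_. lborel)))"

fun msum :: "nat list \<Rightarrow> nat \<Rightarrow> real" where
  "msum [] N = 1"
| "msum (s # ss) N = (\<Sum>k\<in>{1..<N}. msum ss k / real k ^ s)"

fun mpl :: "nat list \<Rightarrow> real \<Rightarrow> real" where
  "mpl [] z = 1"
| "mpl (s # ss) z = (\<Sum>n. z ^ Suc n / real (Suc n) ^ s * msum ss (Suc n))"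

definition mzv :: "nat list \<Rightarrow> real" where
  "mzv ss = mpl ss 1"

definition Acoef :: "nat \<Rightarrow> (nat \<Rightarrow> nat) \<Rightarrow> real" where
  "Acoef m k = 1 / (\<Prod>i\<in>{2..m}. fact (k i))
      / (\<Prod>j\<in>{3..m}. real ((\<Sum>i\<in>{j..m}. k i) + (m - j + 1)))"

text \<open>Subring of the reals generated by the rationals and a set V
  (= values of polynomials with rational coefficients in elements of V).\<close>
inductive_set rat_poly_ring :: "real set \<Rightarrow> real set" for V where
  rat: "of_rat q \<in> rat_poly_ring V"
| gen: "v \<in> V \<Longrightarrow> v \<in> rat_poly_ring V"
| add: "x \<in> rat_poly_ring V \<Longrightarrow> y \<in> rat_poly_ring V \<Longrightarrow> x + y \<in> rat_poly_ring V"
| mult: "x \<in> rat_poly_ring V \<Longrightarrow> y \<in> rat_poly_ring V \<Longrightarrow> x * y \<in> rat_poly_ring V"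

end

theory Submission
  imports Defs
begin

text \<open>The integrand and \<open>W m\<close> are symmetric, so the integral is \<open>m!\<close> times the integral over the points
  with \<open>x\<^sub>1 \<le> \<dots> \<le> x\<^sub>m\<close>, where the conditions defining \<open>W m\<close> reduce to \<open>x\<^sub>1 + x\<^sub>2 \<ge> 1\<close>. Put \<open>t\<^sub>i = - ln x\<^sub>i\<close> and
  expand \<open>(t\<^sub>1 + \<dots> + t\<^sub>m) ^ n\<close> by the multinomial theorem. Integrating out \<open>t\<^sub>m, \<dots>, t\<^sub>3\<close> over
  \<open>0 \<le> t\<^sub>m \<le> \<dots> \<le> t\<^sub>2\<close> produces the denominators of \<open>Acoef\<close> and the power \<open>t\<^sub>2 ^ S\<close>. Then \<open>t\<^sub>1\<close> ranges
  between \<open>t\<^sub>2\<close> and \<open>- ln (1 - x\<^sub>2)\<close>, which leaves the integral of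
  \<open>t\<^sub>2 ^ S * ((- ln (1 - x\<^sub>2)) ^ (k + 1) - t\<^sub>2 ^ (k + 1)) / (k + 1)\<close> over \<open>1/2 \<le> x\<^sub>2 \<le> 1\<close>. Expanding
  \<open>(- ln (1 - x)) ^ (k + 1) / (k + 1)!\<close> as the power series of \<open>Li\<close> at \<open>(1, \<dots>, 1)\<close> and integrating
  termwise gives the zeta value and the values at \<open>1/2\<close>.\<close>

subsection \<open>Powers of the logarithm and multiple polylogarithms\<close>

lemma msum_nonneg: "0 \<le> msum ss N"
  by (induction ss arbitrary: N) (auto intro!: sum_nonneg divide_nonneg_nonneg)

text \<open>These are the Taylor coefficients at 0 of \<open>(- ln (1 - x)) ^ k / fact k\<close>,
  which is the multiple polylogarithm with \<open>k\<close> indices 1. The constant series for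
  \<open>k = 0\<close> needs its own case; for \<open>k > 0\<close> the coefficient at
  \<open>n = 0\<close> is 0 through division by zero.\<close>

definition ln_power_coeff :: "nat \<Rightarrow> nat \<Rightarrow> real" where
  "ln_power_coeff k n = (if k = 0 then of_bool (n = 0) else msum (replicate (k - 1) 1) n / real n)"

text \<open>This is the differential equation F' = G / (1 - x) between consecutive powers, read off
  coefficientwise: multiplication by the geometric series turns coefficients into partial
  sums.\<close>

lemma ln_power_coeff_Suc_Suc:
  "real (Suc n) * ln_power_coeff (Suc k) (Suc n) = (\<Sum>j\<le>n. ln_power_coeff k j)"
proof (cases k)
  case 0
  then show ?thesis by (simp add: ln_power_coeff_def)
next
  case (Suc k')
  \<comment> \<open>Here \<open>k > 0\<close>, so the term at \<open>j = 0\<close> vanishes and the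
    remaining range is the one in \<open>msum\<close>.\<close>
  have "(\<Sum>j\<le>n. ln_power_coeff k j) = (\<Sum>j\<in>{1..<Suc n}. ln_power_coeff k j)"
    by (rule sum.mono_neutral_right) (auto simp: ln_power_coeff_def Suc)
  also have "\<dots> = real (Suc n) * ln_power_coeff (Suc k) (Suc n)"
    by (simp add: ln_power_coeff_def Suc del: of_nat_Suc sum.op_ivl_Suc)
  finally show ?thesis by simp
qed

lemma ln_power_coeff_nonneg: "0 \<le> ln_power_coeff k n"
  by (simp add: ln_power_coeff_def msum_nonneg)

text \<open>By the recurrence each coefficient is an average of coefficients of the previous level.
  The crude bound suffices for absolute convergence inside the unit disc.\<close>

lemma ln_power_coeff_le_1: "ln_power_coeff k n \<le> 1"
proof (induction k arbitrary: n)
  case 0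
  then show ?case by (simp add: ln_power_coeff_def)
next
  case (Suc k)
  show ?case
  proof (cases n)
    case 0
    then show ?thesis by (simp add: ln_power_coeff_def)
  next
    case (Suc n')
    have "(\<Sum>j\<le>n'. ln_power_coeff k j) \<le> (\<Sum>j\<le>n'. 1)"
      by (intro sum_mono Suc.IH)
    then have "real (Suc n') * ln_power_coeff (Suc k) (Suc n') \<le> real (Suc n') * 1"
      unfolding ln_power_coeff_Suc_Suc by simp
    then show ?thesis
      using Suc by (simp del: of_nat_Suc)
  qed
qed

lemma summable_ln_power_coeff:
  assumes "\<bar>x\<bar> < 1"
  shows "summable (\<lambda>n. norm (ln_power_coeff k n * x ^ n))"
proof (rule summable_comparison_test)
  show "\<exists>N. \<forall>n\<ge>N. norm (norm (ln_power_coeff k n * x ^ n)) \<le> \<bar>x\<bar> ^ n"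
    using ln_power_coeff_nonneg ln_power_coeff_le_1
    by (auto simp: abs_mult power_abs intro!: mult_left_le_one_le)
  show "summable (\<lambda>n. \<bar>x\<bar> ^ n)"
    using assms by (simp add: summable_geometric_iff)
qed

text \<open>Both sides of the expansion for \<open>k + 1\<close> vanish at \<open>0\<close>, and both have as derivative
  \<open>1 / (1 - x)\<close> times the expansion for \<open>k\<close>.\<close>

lemma ln_power_sums:
  fixes x :: real
  assumes "\<bar>x\<bar> < 1"
  shows "(\<lambda>n. ln_power_coeff k n * x ^ n) sums ((- ln (1 - x)) ^ k / fact k)"
  using assms
proof (induction k arbitrary: x)
  case 0
  have "(\<lambda>n. ln_power_coeff 0 n * x ^ n) = (\<lambda>n. if n = 0 then 1 else 0)"
    by (auto simp: ln_power_coeff_def)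
  then show ?case
    using sums_single[of 0 "\<lambda>_. 1::real"] by simp
next
  case (Suc k)
  define F where "F y = (\<Sum>n. ln_power_coeff (Suc k) n * y ^ n)" for y :: real
  define G where "G y = (- ln (1 - y)) ^ Suc k / fact (Suc k)" for y :: real
  have F': "(F has_field_derivative (- ln (1 - y)) ^ k / fact k / (1 - y)) (at y)" if y: "\<bar>y\<bar> < 1" for y
  proof -
    \<comment> \<open>Termwise differentiation at \<open>y\<close> requires convergence at some
      point of strictly larger modulus.\<close>
    obtain K where K: "\<bar>y\<bar> < K" "K < 1"
      using y dense by blast
    have "summable (\<lambda>n. ln_power_coeff (Suc k) n * K ^ n)"
      using K by (intro summable_norm_cancel[OF summable_ln_power_coeff]) auto
    then have *: "(F has_field_derivative (\<Sum>n. diffs (ln_power_coeff (Suc k)) n * y ^ n)) (at y)"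
      unfolding F_def[abs_def] using K by (intro termdiffs_strong) auto
    \<comment> \<open>The Cauchy product with the geometric series supplies the factor
      \<open>1 / (1 - y)\<close>; its coefficients match the differentiated series by the
      recurrence.\<close>
    have "(\<lambda>n. \<Sum>i\<le>n. (ln_power_coeff k i * y ^ i) * y ^ (n - i)) sums
        ((\<Sum>n. ln_power_coeff k n * y ^ n) * (\<Sum>n. y ^ n))"
      using y by (intro Cauchy_product_sums summable_ln_power_coeff)
        (auto simp: summable_geometric_iff power_abs)
    moreover have "(\<Sum>i\<le>n. (ln_power_coeff k i * y ^ i) * y ^ (n - i)) =
        diffs (ln_power_coeff (Suc k)) n * y ^ n" for n
    proof -
      have "(\<Sum>i\<le>n. (ln_power_coeff k i * y ^ i) * y ^ (n - i)) = (\<Sum>i\<le>n. ln_power_coeff k i * y ^ n)"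
        by (intro sum.cong) (auto simp: mult.assoc simp flip: power_add)
      then show ?thesis
        by (simp add: diffs_def ln_power_coeff_Suc_Suc sum_distrib_right del: of_nat_Suc)
    qed
    moreover have "(\<Sum>n. ln_power_coeff k n * y ^ n) = (- ln (1 - y)) ^ k / fact k"
      using Suc.IH[OF y] by (simp add: sums_iff)
    moreover have "(\<Sum>n. y ^ n) = 1 / (1 - y)"
      using y by (simp add: suminf_geometric)
    ultimately have "(\<Sum>n. diffs (ln_power_coeff (Suc k)) n * y ^ n) = (- ln (1 - y)) ^ k / fact k / (1 - y)"
      by (simp add: sums_iff)
    with * show ?thesis by simp
  qed
  have G': "(G has_field_derivative (- ln (1 - y)) ^ k / fact k / (1 - y)) (at y)" if y: "\<bar>y\<bar> < 1" for y
  proof -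
    have "((\<lambda>y. - ln (1 - y)) has_field_derivative 1 / (1 - y)) (at y)"
      using y by (auto intro!: derivative_eq_intros simp: field_simps)
    from DERIV_cdivide[OF DERIV_power[OF this, of "Suc k"], of "fact (Suc k)"] show ?thesis
      unfolding G_def[abs_def] by (rule DERIV_cong) (simp del: of_nat_Suc)
  qed
  have "\<exists>c. \<forall>y\<in>ball 0 1. F y - G y = c"
  proof (rule has_field_derivative_zero_constant)
    fix y :: real assume "y \<in> ball 0 1"
    then have "\<bar>y\<bar> < 1" by simp
    from DERIV_diff[OF F'[OF this] G'[OF this]]
    show "((\<lambda>y. F y - G y) has_field_derivative 0) (at y within ball 0 1)"
      by (simp add: has_field_derivative_at_within)
  qed auto
  then obtain c where c: "\<And>y. \<bar>y\<bar> < 1 \<Longrightarrow> F y - G y = c"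
    by auto
  have "F 0 = ln_power_coeff (Suc k) 0"
    unfolding F_def by (rule powser_zero)
  then have "F 0 = 0"
    by (simp add: ln_power_coeff_def)
  moreover have "G 0 = 0" by (simp add: G_def)
  ultimately have "c = 0" using c[of 0] by simp
  with c[of x] Suc.prems have "F x = G x" by simp
  moreover have "summable (\<lambda>n. ln_power_coeff (Suc k) n * x ^ n)"
    using Suc.prems by (intro summable_norm_cancel[OF summable_ln_power_coeff]) auto
  ultimately show ?case
    unfolding F_def G_def sums_iff by blast
qed

text \<open>The sum telescopes: with a, b the roots of N and N + 1, the bound 1/b \<le> 2 (b - a)
  amounts to (b - a)^2 \<ge> 0, because b^2 = a^2 + 1.\<close>

lemma sum_inverse_sqrt_le: "(\<Sum>k\<in>{1..N}. 1 / sqrt (real k)) \<le> 2 * sqrt (real N)"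
proof (induction N)
  case (Suc N)
  define a b where "a = sqrt (real N)" and "b = sqrt (real (Suc N))"
  have ab: "0 \<le> a" "0 < b" "b * b = a * a + 1"
    by (auto simp: a_def b_def)
  have "0 \<le> (b - a) * (b - a)" by simp
  with ab(3) have "(2 * a + 1 / b) * b \<le> (2 * b) * b"
    using ab(2) by (simp add: algebra_simps)
  then have "2 * a + 1 / b \<le> 2 * b"
    using ab(2) by simp
  with Suc.IH show ?case
    by (simp add: a_def b_def)
qed simp

text \<open>Each level of nesting divides a square root by its index and sums again, at the cost of
  a factor 2. The true growth is a power of a logarithm, but any exponent below 1 is enough for
  convergence.\<close>

lemma msum_replicate_le: "msum (replicate k 1) (Suc N) \<le> 2 ^ k * sqrt (real (Suc N))"
proof (induction k arbitrary: N)
  case (Suc k)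
  have "msum (replicate (Suc k) 1) (Suc N) = (\<Sum>j\<in>{1..N}. msum (replicate k 1) j / real j)"
    by (simp add: atLeastLessThanSuc_atLeastAtMost del: sum.op_ivl_Suc)
  also have "\<dots> \<le> (\<Sum>j\<in>{1..N}. 2 ^ k * (1 / sqrt (real j)))"
  proof (rule sum_mono)
    fix j assume j: "j \<in> {1..N}"
    then obtain i where "j = Suc i" by (cases j) auto
    with Suc.IH[of i] have "msum (replicate k 1) j / real j \<le> 2 ^ k * sqrt (real j) / real j"
      by (intro divide_right_mono) auto
    also have "\<dots> = 2 ^ k * (1 / sqrt (real j))"
      using j by (simp add: real_div_sqrt field_simps)
    finally show "msum (replicate k 1) j / real j \<le> 2 ^ k * (1 / sqrt (real j))" .
  qed
  also have "\<dots> = 2 ^ k * (\<Sum>j\<in>{1..N}. 1 / sqrt (real j))"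
    by (simp only: sum_distrib_left)
  also have "\<dots> \<le> 2 ^ k * (2 * sqrt (real N))"
    by (intro mult_left_mono sum_inverse_sqrt_le) auto
  also have "\<dots> \<le> 2 ^ Suc k * sqrt (real (Suc N))"
    by simp
  finally show ?case .
qed simp

text \<open>The worst case is \<open>s = 2\<close>, where the square root bound still leaves the
  summable exponent -3/2.\<close>

lemma summable_mzv:
  assumes "s \<ge> 2"
  shows "summable (\<lambda>n. msum (replicate k 1) (Suc n) / real (Suc n) ^ s)"
proof (rule summable_comparison_test)
  have "summable (\<lambda>n. real (Suc n) powr (- 3/2))"
    by (subst summable_Suc_iff) (simp add: summable_real_powr_iff)
  then show "summable (\<lambda>n. 2 ^ k * real (Suc n) powr (- 3/2))"
    by (rule summable_mult)
  have "msum (replicate k 1) (Suc n) / real (Suc n) ^ s \<le> 2 ^ k * real (Suc n) powr (- 3/2)" for n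
  proof -
    have "msum (replicate k 1) (Suc n) / real (Suc n) ^ s \<le> 2 ^ k * sqrt (real (Suc n)) / real (Suc n) ^ 2"
      using assms by (intro frac_le msum_replicate_le power_increasing) (auto intro: msum_nonneg)
    also have "sqrt (real (Suc n)) / real (Suc n) ^ 2 = real (Suc n) powr (1/2 - 2)"
      by (simp only: powr_diff powr_half_sqrt powr_numeral of_nat_0_le_iff of_nat_0_less_iff zero_less_Suc)
    then have "2 ^ k * sqrt (real (Suc n)) / real (Suc n) ^ 2 = 2 ^ k * real (Suc n) powr (- 3/2)"
      by (simp del: of_nat_Suc flip: times_divide_eq_right)
    finally show ?thesis .
  qed
  then show "\<exists>N. \<forall>n\<ge>N. norm (msum (replicate k 1) (Suc n) / real (Suc n) ^ s) \<le> 2 ^ k * real (Suc n) powr (- 3/2)"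
    by (auto simp: msum_nonneg simp del: of_nat_Suc)
qed

text \<open>The antiderivative comes from repeated integration by parts. Nonnegativity is recorded
  separately because \<open>ennreal\<close> sends negative reals to 0, so the first equation alone
  does not give it.\<close>

lemma integral_pow_mult_ln_power:
  assumes "0 < a" "a \<le> 1"
  shows "(\<integral>\<^sup>+x. ennreal (x ^ n * (- ln x) ^ s) * indicator {a..1} x \<partial>lborel) =
    ennreal (fact s / real (Suc n) ^ Suc s -
      fact s * (\<Sum>p\<le>s. (- ln a) ^ p / fact p * (a ^ Suc n / real (Suc n) ^ (Suc s - p))))"
      (is ?integral)
    and "0 \<le> fact s / real (Suc n) ^ Suc s -
      fact s * (\<Sum>p\<le>s. (- ln a) ^ p / fact p * (a ^ Suc n / real (Suc n) ^ (Suc s - p)))"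
      (is ?nonneg)
proof -
  define F where "F x = fact s * (\<Sum>p\<le>s. (- ln x) ^ p / fact p * (x ^ Suc n / real (Suc n) ^ (Suc s - p)))" for x :: real
  have F': "(F has_real_derivative x ^ n * (- ln x) ^ s) (at x)" if "x > 0" for x
  proof -
    \<comment> \<open>The \<open>p\<close>-th summand of the antiderivative has derivative
      \<open>g p - g (p - 1)\<close>, up to the factor \<open>fact s\<close>, so the derivatives
      telescope to \<open>g s\<close>.\<close>
    define g where "g p = (- ln x) ^ p / fact p * (x ^ n / real (Suc n) ^ (s - p))" for p
    have "((\<lambda>x. (- ln x) ^ p / fact p * (x ^ Suc n / real (Suc n) ^ (Suc s - p))) has_real_derivative
       (if p = 0 then 0 else - g (p - 1)) + g p) (at x)" if "p \<le> s" for p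
    proof -
      have dpow: "((\<lambda>x. x ^ Suc n / real (Suc n) ^ (Suc s - p)) has_real_derivative x ^ n / real (Suc n) ^ (s - p)) (at x)"
      proof -
        have "((\<lambda>x. x ^ Suc n / real (Suc n) ^ (Suc s - p)) has_real_derivative
            real (Suc n) * x ^ n / real (Suc n) ^ (Suc s - p)) (at x)"
          using DERIV_pow[of "Suc n" x] by (intro DERIV_cdivide) auto
        then show ?thesis
          using that by (simp add: Suc_diff_le del: of_nat_Suc)
      qed
      have dln: "((\<lambda>x. (- ln x) ^ p / fact p) has_real_derivative
          (if p = 0 then 0 else - ((- ln x) ^ (p - 1) / fact (p - 1) / x))) (at x)"
      proof (cases p)
        case (Suc q)
        have "((\<lambda>x. (- ln x) ^ Suc q / fact (Suc q)) has_real_derivative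
            real (Suc q) * ((- ln x) ^ q * - (1 / x)) / fact (Suc q)) (at x)"
          using \<open>x > 0\<close> DERIV_power[OF DERIV_minus[OF DERIV_ln_divide[of x]], of "Suc q"]
          by (intro DERIV_cdivide) auto
        then show ?thesis
          by (simp add: Suc field_simps del: of_nat_Suc)
      qed simp
      from DERIV_mult[OF dln dpow] show ?thesis
      proof (rule DERIV_cong)
        show "(if p = 0 then 0 else - ((- ln x) ^ (p - 1) / fact (p - 1) / x)) *
            (x ^ Suc n / real (Suc n) ^ (Suc s - p)) + x ^ n / real (Suc n) ^ (s - p) * ((- ln x) ^ p / fact p) =
          (if p = 0 then 0 else - g (p - 1)) + g p"
          using that \<open>x > 0\<close> by (cases p) (simp_all add: g_def mult_ac del: of_nat_Suc)
      qed
    qed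
    then have "(F has_real_derivative fact s * (\<Sum>p\<le>s. (if p = 0 then 0 else - g (p - 1)) + g p)) (at x)"
      unfolding F_def[abs_def] by (intro DERIV_cmult DERIV_sum) auto
    also have "(\<Sum>p\<le>s. (if p = 0 then 0 else - g (p - 1)) + g p) = g s"
      by (induction s) auto
    also have "fact s * g s = x ^ n * (- ln x) ^ s"
      by (simp add: g_def)
    finally show ?thesis .
  qed
  have "(\<integral>\<^sup>+x. ennreal (x ^ n * (- ln x) ^ s) * indicator {a..1} x \<partial>lborel) = F 1 - F a"
  proof (rule nn_integral_FTC_Icc)
    show "(\<lambda>x::real. x ^ n * (- ln x) ^ s) \<in> borel_measurable borel"
      by measurable
    fix x assume x: "x \<in> {a..1}"
    with assms have "0 < x" "x \<le> 1" by auto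
    then show "0 \<le> x ^ n * (- ln x) ^ s"
      by (intro mult_nonneg_nonneg zero_le_power) auto
    show "(F has_real_derivative x ^ n * (- ln x) ^ s) (at x)"
      using \<open>0 < x\<close> by (rule F')
  qed (use assms in auto)
  moreover have F1: "F 1 = fact s / real (Suc n) ^ Suc s"
  proof -
    \<comment> \<open>Since \<open>ln 1 = 0\<close>, only the term with \<open>p = 0\<close>
      survives.\<close>
    have "F 1 = fact s * (\<Sum>p\<le>s. if p = 0 then 1 / real (Suc n) ^ Suc s else 0)"
      unfolding F_def by (intro arg_cong2[where f = "(*)"] sum.cong) (auto simp: power_0_left)
    also have "\<dots> = fact s / real (Suc n) ^ Suc s"
      by (simp only: sum.delta finite_atMost) simp
    finally show ?thesis .
  qed
  ultimately show ?integral
    by (simp add: F_def)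
  have "F a \<le> F 1"
  proof (rule DERIV_nonneg_imp_nondecreasing[of a 1 F])
    fix x assume "a \<le> x" "x \<le> 1"
    with assms have x: "0 < x" "x \<le> 1" by auto
    then have "0 \<le> x ^ n * (- ln x) ^ s"
      by (intro mult_nonneg_nonneg zero_le_power) auto
    with F'[OF x(1)] show "\<exists>y. (F has_real_derivative y) (at x) \<and> 0 \<le> y" by blast
  qed fact
  with F1 show ?nonneg
    by (simp add: F_def)
qed

section \<open>Zeta values and values at 1/2 as sums of series, and the integral they
  evaluate\<close>

lemma summable_mpl_half:
  assumes "s \<ge> 2"
  shows "summable (\<lambda>n. (1/2) ^ Suc n / real (Suc n) ^ s * msum (replicate k 1) (Suc n))"
proof (rule summable_comparison_test[OF _ summable_mzv[OF assms]])
  have "(1/2::real) ^ Suc n / real (Suc n) ^ s * msum (replicate k 1) (Suc n) \<le>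
      1 / real (Suc n) ^ s * msum (replicate k 1) (Suc n)" for n
    by (intro mult_right_mono divide_right_mono power_le_one msum_nonneg) auto
  then show "\<exists>N. \<forall>n\<ge>N. norm ((1/2) ^ Suc n / real (Suc n) ^ s * msum (replicate k 1) (Suc n)) \<le>
      msum (replicate k 1) (Suc n) / real (Suc n) ^ s"
    by (simp add: msum_nonneg)
qed

lemma mzv_sums:
  assumes "s \<ge> 2"
  shows "(\<lambda>n. msum (replicate k 1) (Suc n) / real (Suc n) ^ s) sums mzv (s # replicate k 1)"
  using summable_sums[OF summable_mzv[OF assms]] by (simp add: mzv_def del: of_nat_Suc)

lemma mpl_half_sums:
  assumes "s \<ge> 2"
  shows "(\<lambda>n. (1/2) ^ Suc n / real (Suc n) ^ s * msum (replicate k 1) (Suc n)) sums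
    mpl (s # replicate k 1) (1/2)"
  using summable_sums[OF summable_mpl_half[OF assms]] by (simp only: mpl.simps)

text \<open>The power of \<open>- ln (1 - x)\<close> is expanded in powers of \<open>x\<close>; all
  terms are nonnegative, so integration is termwise. In each term the upper limit 1 contributes to
  the zeta value and the lower limit 1/2 to the polylogarithms.\<close>

lemma integral_ln_power_mult_ln_one_minus_power:
  defines "V S k \<equiv> fact S * mzv ((S + 2) # replicate k 1) -
      fact S * (\<Sum>p = 0..S. ln 2 ^ p / fact p * mpl ((S + 2 - p) # replicate k 1) (1/2))"
  shows "(\<integral>\<^sup>+x. ennreal ((- ln x) ^ S / x * ((- ln (1 - x)) ^ Suc k / fact (Suc k))) *
      indicator {1/2..1} x \<partial>lborel) = ennreal (V S k)"
    and "0 \<le> V S k"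
proof -
  \<comment> \<open>\<open>b n\<close> is the integral of \<open>x ^ n * (- ln x) ^ S\<close> over
    \<open>{1/2..1}\<close>, and \<open>c n\<close> weights it by the Taylor coefficient.\<close>
  define b where "b n = fact S / real (Suc n) ^ Suc S -
      fact S * (\<Sum>p\<le>S. ln 2 ^ p / fact p * ((1/2) ^ Suc n / real (Suc n) ^ (Suc S - p)))" for n
  define c where "c n = ln_power_coeff (Suc k) (Suc n) * b n" for n
  have ln_half: "- ln (1/2 :: real) = ln 2"
    by (simp add: ln_div)
  have b_nonneg: "0 \<le> b n" for n
    using integral_pow_mult_ln_power(2)[of "1/2" S n] by (simp add: ln_half b_def)
  have c_nonneg: "0 \<le> c n" for n
    by (simp add: c_def b_nonneg ln_power_coeff_nonneg)
  have "(\<lambda>n. fact S * (msum (replicate k 1) (Suc n) / real (Suc n) ^ (S + 2)) -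
      fact S * (\<Sum>p = 0..S. ln 2 ^ p / fact p *
        ((1/2) ^ Suc n / real (Suc n) ^ (S + 2 - p) * msum (replicate k 1) (Suc n)))) sums V S k"
    unfolding V_def by (intro sums_diff sums_mult sums_sum mzv_sums mpl_half_sums) auto
  also have "(\<lambda>n. fact S * (msum (replicate k 1) (Suc n) / real (Suc n) ^ (S + 2)) -
      fact S * (\<Sum>p = 0..S. ln 2 ^ p / fact p *
        ((1/2) ^ Suc n / real (Suc n) ^ (S + 2 - p) * msum (replicate k 1) (Suc n)))) = c"
  proof
    fix n
    define t where "t = msum (replicate k 1) (Suc n)"
    \<comment> \<open>The Taylor coefficient carries a factor \<open>1 / real (Suc n)\<close>, which
      accounts for the exponent \<open>S + 2 - p\<close> in place of
      \<open>Suc S - p\<close>.\<close>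
    have "(\<Sum>p = 0..S. ln 2 ^ p / fact p * ((1/2) ^ Suc n / real (Suc n) ^ (S + 2 - p) * t)) =
      t / real (Suc n) * (\<Sum>p\<le>S. ln 2 ^ p / fact p * ((1/2) ^ Suc n / real (Suc n) ^ (Suc S - p)))"
      unfolding sum_distrib_left atLeast0AtMost
      by (intro sum.cong) (auto simp: Suc_diff_le mult_ac simp del: of_nat_Suc)
    moreover have "ln_power_coeff (Suc k) (Suc n) = t / real (Suc n)"
      by (simp add: ln_power_coeff_def t_def)
    ultimately show "fact S * (msum (replicate k 1) (Suc n) / real (Suc n) ^ (S + 2)) -
      fact S * (\<Sum>p = 0..S. ln 2 ^ p / fact p *
        ((1/2) ^ Suc n / real (Suc n) ^ (S + 2 - p) * msum (replicate k 1) (Suc n))) = c n"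
      unfolding c_def b_def t_def[symmetric]
      by (simp add: right_diff_distrib mult_ac del: of_nat_Suc)
  qed
  finally have c_sums: "c sums V S k" .
  show "0 \<le> V S k"
    using c_nonneg c_sums by (rule sums_le[OF _ sums_zero])
  have "(\<integral>\<^sup>+x. ennreal ((- ln x) ^ S / x * ((- ln (1 - x)) ^ Suc k / fact (Suc k))) *
      indicator {1/2..1} x \<partial>lborel) =
    (\<integral>\<^sup>+x. (\<Sum>n. ennreal (ln_power_coeff (Suc k) (Suc n)) *
      (ennreal (x ^ n * (- ln x) ^ S) * indicator {1/2..1} x)) \<partial>lborel)"
  proof (rule nn_integral_cong_AE)
    \<comment> \<open>The point 1 is left out because the power series expansion is only available
      for \<open>x < 1\<close>.\<close>
    have "ennreal ((- ln x) ^ S / x * ((- ln (1 - x)) ^ Suc k / fact (Suc k))) * indicator {1/2..1} x =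
      (\<Sum>n. ennreal (ln_power_coeff (Suc k) (Suc n)) * (ennreal (x ^ n * (- ln x) ^ S) * indicator {1/2..1} x))"
      if "x \<noteq> 1" for x :: real
    proof (cases "x \<in> {1/2..1}")
      case True
      with that have x: "1/2 \<le> x" "x < 1" by auto
      \<comment> \<open>The coefficient at index 0 vanishes, so the series may start at
        \<open>x ^ 1\<close>; the factor \<open>1 / x\<close> then leaves
        \<open>x ^ n\<close>.\<close>
      have "(\<lambda>n. ln_power_coeff (Suc k) (Suc n) * x ^ Suc n) sums ((- ln (1 - x)) ^ Suc k / fact (Suc k))"
        using ln_power_sums[of x "Suc k"] x
        by (subst sums_Suc_iff) (simp add: ln_power_coeff_def)
      from sums_mult[OF this, of "(- ln x) ^ S / x"]
      have "(\<lambda>n. ln_power_coeff (Suc k) (Suc n) * (x ^ n * (- ln x) ^ S)) sums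
          ((- ln x) ^ S / x * ((- ln (1 - x)) ^ Suc k / fact (Suc k)))"
        using x by (simp add: field_simps)
      moreover have "0 \<le> x ^ n * (- ln x) ^ S" for n
        using x by (intro mult_nonneg_nonneg zero_le_power) auto
      ultimately show ?thesis
        using True ln_power_coeff_nonneg
        by (simp add: sums_iff suminf_ennreal2 flip: ennreal_mult)
    qed simp
    then show "AE x in lborel. ennreal ((- ln x) ^ S / x * ((- ln (1 - x)) ^ Suc k / fact (Suc k))) * indicator {1/2..1} x =
      (\<Sum>n. ennreal (ln_power_coeff (Suc k) (Suc n)) * (ennreal (x ^ n * (- ln x) ^ S) * indicator {1/2..1} x))"
      using AE_lborel_singleton[of "1::real"] by (auto elim: eventually_mono)
  qed
  also have "\<dots> = (\<Sum>n. ennreal (ln_power_coeff (Suc k) (Suc n)) *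
      (\<integral>\<^sup>+x. ennreal (x ^ n * (- ln x) ^ S) * indicator {1/2..1} x \<partial>lborel))"
    by (simp add: nn_integral_suminf nn_integral_cmult)
  also have "\<dots> = (\<Sum>n. ennreal (c n))"
    using integral_pow_mult_ln_power(1)[of "1/2"]
    by (simp add: ln_half c_def b_def ennreal_mult' ln_power_coeff_nonneg del: of_nat_Suc)
  also have "\<dots> = ennreal (V S k)"
    using c_nonneg c_sums by (simp add: sums_iff suminf_ennreal2)
  finally show "(\<integral>\<^sup>+x. ennreal ((- ln x) ^ S / x * ((- ln (1 - x)) ^ Suc k / fact (Suc k))) *
      indicator {1/2..1} x \<partial>lborel) = ennreal (V S k)" .
qed

text \<open>With t = - ln x this is the integral of t^k. It serves for the correction term in
  \<open>wedge_value\<close>, for the variables above the second one, and for the smallest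
  variable.\<close>

lemma nn_integral_ln_power_over_x:
  assumes "0 < a" "a \<le> b" "b \<le> 1"
  shows "(\<integral>\<^sup>+x. ennreal ((- ln x) ^ k / x) * indicator {a..b} x \<partial>lborel) =
    ennreal (((- ln a) ^ Suc k - (- ln b) ^ Suc k) / real (Suc k))"
proof -
  define F where "F x = - ((- ln x) ^ Suc k / real (Suc k))" for x :: real
  have "(\<integral>\<^sup>+x. ennreal ((- ln x) ^ k / x) * indicator {a..b} x \<partial>lborel) = F b - F a"
  proof (rule nn_integral_FTC_Icc)
    show "(\<lambda>x::real. (- ln x) ^ k / x) \<in> borel_measurable borel"
      by measurable
    fix x assume x: "x \<in> {a..b}"
    with assms have "0 < x" "x \<le> 1" by auto
    then show "0 \<le> (- ln x) ^ k / x"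
      by (intro divide_nonneg_nonneg zero_le_power) auto
    have "((\<lambda>x. - ln x) has_real_derivative - (1 / x)) (at x)"
      using \<open>0 < x\<close> by (auto intro!: derivative_eq_intros)
    from DERIV_minus[OF DERIV_cdivide[OF DERIV_power[OF this, of "Suc k"], of "real (Suc k)"]]
    show "(F has_real_derivative (- ln x) ^ k / x) (at x)"
      unfolding F_def[abs_def] by (rule DERIV_cong) (simp del: of_nat_Suc)
  qed (use assms in auto)
  then show ?thesis
    by (simp add: F_def diff_divide_distrib)
qed

text \<open>With \<open>t = - ln x\<close>, \<open>wedge_value S k\<close> is the integral of \<open>t\<^sub>1 ^ k / k! * t\<^sub>2 ^ S\<close> over the region
  \<open>0 \<le> t\<^sub>2 \<le> t\<^sub>1\<close>, \<open>exp (- t\<^sub>1) + exp (- t\<^sub>2) \<ge> 1\<close>; below, \<open>t\<^sub>1\<close> is already integrated out.\<close>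

definition wedge_value :: "nat \<Rightarrow> nat \<Rightarrow> real" where
  "wedge_value S k = fact S * mzv ((S + 2) # replicate k 1) -
      ln 2 ^ (S + k + 2) / (fact (k + 1) * real (S + k + 2)) -
      fact S * (\<Sum>p = 0..S. ln 2 ^ p / fact p * mpl ((S + 2 - p) # replicate k 1) (1/2))"

text \<open>The integrand is a difference \<open>f - g\<close> of nonnegative functions with
  integrals \<open>V\<close> and \<open>U\<close>, and the latter is elementary. Since
  \<open>g\<close> is almost everywhere at most \<open>f\<close> and has finite integral, the
  integrals may be subtracted; the same comparison gives nonnegativity.\<close>

lemma
  shows nn_integral_wedge: "(\<integral>\<^sup>+x. ennreal ((- ln x) ^ S / x * (((- ln (1 - x)) ^ Suc k - (- ln x) ^ Suc k) / fact (Suc k))) *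
      indicator {1/2..1} x \<partial>lborel) = ennreal (wedge_value S k)" (is "?D = _")
    and wedge_value_nonneg: "0 \<le> wedge_value S k"
proof -
  define V where "V = fact S * mzv ((S + 2) # replicate k 1) -
      fact S * (\<Sum>p = 0..S. ln 2 ^ p / fact p * mpl ((S + 2 - p) # replicate k 1) (1/2))"
  define U :: real where "U = ln 2 ^ (S + k + 2) / (fact (k + 1) * real (S + k + 2))"
  define f where "f x = ennreal ((- ln x) ^ S / x * ((- ln (1 - x)) ^ Suc k / fact (Suc k))) * indicator {1/2..1} x" for x :: real
  define g where "g x = ennreal ((- ln x) ^ S / x * ((- ln x) ^ Suc k / fact (Suc k))) * indicator {1/2..1} x" for x :: real
  have V: "integral\<^sup>N lborel f = ennreal V" "0 \<le> V"
    using integral_ln_power_mult_ln_one_minus_power[of S k] by (simp_all add: f_def[abs_def] V_def)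
  have "0 \<le> U" by (simp add: U_def)
  have "integral\<^sup>N lborel g = (\<integral>\<^sup>+x. ennreal (1 / fact (Suc k)) * (ennreal ((- ln x) ^ (S + Suc k) / x) * indicator {1/2..1} x) \<partial>lborel)"
    by (intro nn_integral_cong) (auto simp: g_def indicator_def power_add mult_ac simp flip: ennreal_mult')
  also have "\<dots> = ennreal (1 / fact (Suc k)) * (\<integral>\<^sup>+x. ennreal ((- ln x) ^ (S + Suc k) / x) * indicator {1/2..1} x \<partial>lborel)"
    by (intro nn_integral_cmult) auto
  also have "\<dots> = ennreal U"
    unfolding nn_integral_ln_power_over_x[of "1/2" 1, simplified]
    by (simp add: U_def ln_div flip: ennreal_mult' del: fact_Suc)
  finally have U: "integral\<^sup>N lborel g = ennreal U" .
  \<comment> \<open>For \<open>x\<close> at least 1/2 one has \<open>1 - x \<le> x\<close>, hence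
    \<open>- ln x \<le> - ln (1 - x)\<close>.\<close>
  have dom: "0 \<le> (- ln x) ^ S / x" "0 \<le> (- ln x) ^ Suc k / fact (Suc k)" 
      "(- ln x) ^ Suc k / fact (Suc k) \<le> (- ln (1 - x)) ^ Suc k / fact (Suc k)"
    if "1/2 \<le> x" "x < 1" for x :: real
    using that by (auto intro!: divide_nonneg_nonneg zero_le_power divide_right_mono power_mono simp del: power_Suc fact_Suc)
  have AE1: "AE x in lborel. x \<noteq> (1::real)"
    by (rule AE_lborel_singleton)
  have le: "AE x in lborel. g x \<le> f x"
    using AE1
  proof eventually_elim
    case (elim x)
    show ?case
    proof (cases "x \<in> {1/2..1}")
      case True
      with elim have "1/2 \<le> x" "x < 1" by auto
      from dom[OF this] show ?thesis
        unfolding f_def g_def by (intro mult_right_mono ennreal_leI mult_left_mono) auto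
    qed (simp add: f_def g_def)
  qed
  have "?D = (\<integral>\<^sup>+x. f x - g x \<partial>lborel)"
    using AE1
  proof (intro nn_integral_cong_AE, eventually_elim)
    case (elim x)
    show ?case
    proof (cases "x \<in> {1/2..1}")
      case True
      with elim have "1/2 \<le> x" "x < 1" by auto
      note d = dom[OF this]
      have "f x - g x = ennreal ((- ln x) ^ S / x * ((- ln (1 - x)) ^ Suc k / fact (Suc k)) -
          (- ln x) ^ S / x * ((- ln x) ^ Suc k / fact (Suc k)))"
        using True d by (simp add: f_def g_def ennreal_minus del: fact_Suc power_Suc)
      then show ?thesis
        using True by (simp add: diff_divide_distrib right_diff_distrib del: fact_Suc power_Suc)
    qed (simp add: f_def g_def)
  qed
  also have "\<dots> = integral\<^sup>N lborel f - integral\<^sup>N lborel g"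
    using le U by (intro nn_integral_diff) (auto simp: f_def[abs_def] g_def[abs_def])
  also have "\<dots> = ennreal (V - U)"
    using \<open>0 \<le> U\<close> by (simp add: U V ennreal_minus)
  also have "V - U = wedge_value S k"
    by (simp add: V_def U_def wedge_value_def)
  finally show "?D = ennreal (wedge_value S k)" .
  have "ennreal U \<le> ennreal V"
    using nn_integral_mono_AE[OF le] by (simp add: U V)
  with V(2) show "0 \<le> wedge_value S k"
    by (simp add: V_def U_def wedge_value_def)
qed

subsection \<open>Symmetric integrands on product spaces\<close>

text \<open>The preimage of a box is the box with its sides rearranged by
  \<open>inv \<sigma>\<close>, and the product of the side measures does not depend on their order.
  Boxes determine the product measure.\<close>

lemma distr_PiM_permutes:
  assumes "sigma_finite_measure N" and I: "finite I" and \<sigma>: "\<sigma> permutes I"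
  shows "distr (PiM I (\<lambda>_. N)) (PiM I (\<lambda>_. N)) (\<lambda>x. \<lambda>i\<in>I. x (\<sigma> i)) = PiM I (\<lambda>_. N)"
proof -
  interpret sigma_finite_measure N by fact
  interpret product_sigma_finite "\<lambda>_. N" ..
  have \<sigma>_in: "\<sigma> i \<in> I" if "i \<in> I" for i
    using permutes_in_image[OF \<sigma>] that by simp
  have meas [measurable]: "(\<lambda>x. \<lambda>i\<in>I. x (\<sigma> i)) \<in> PiM I (\<lambda>_. N) \<rightarrow>\<^sub>M PiM I (\<lambda>_. N)"
    by (intro measurable_restrict measurable_component_singleton \<sigma>_in)
  show ?thesis
  proof (rule PiM_eqI)
    fix A assume A: "\<And>i. i \<in> I \<Longrightarrow> A i \<in> sets N"
    have inv_in: "inv \<sigma> i \<in> I" if "i \<in> I" for i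
      using permutes_in_image[OF permutes_inv[OF \<sigma>]] that by simp
    have "(\<lambda>x. \<lambda>i\<in>I. x (\<sigma> i)) -` Pi\<^sub>E I A \<inter> space (PiM I (\<lambda>_. N)) = Pi\<^sub>E I (\<lambda>i. A (inv \<sigma> i))"
    proof (intro set_eqI iffI)
      fix x assume x: "x \<in> (\<lambda>x. \<lambda>i\<in>I. x (\<sigma> i)) -` Pi\<^sub>E I A \<inter> space (PiM I (\<lambda>_. N))"
      have "x i \<in> A (inv \<sigma> i)" if "i \<in> I" for i
      proof -
        have "(\<lambda>i\<in>I. x (\<sigma> i)) (inv \<sigma> i) \<in> A (inv \<sigma> i)"
          using x inv_in[OF that] by (auto simp: PiE_iff)
        then show ?thesis
          using inv_in[OF that] permutes_inverses(1)[OF \<sigma>] by simp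
      qed
      then show "x \<in> Pi\<^sub>E I (\<lambda>i. A (inv \<sigma> i))"
        using x by (auto simp: space_PiM PiE_iff)
    next
      fix x assume x: "x \<in> Pi\<^sub>E I (\<lambda>i. A (inv \<sigma> i))"
      have "x (\<sigma> i) \<in> A i" if "i \<in> I" for i
        using x \<sigma>_in[OF that] permutes_inverses(2)[OF \<sigma>] by (force simp: PiE_iff)
      moreover have "x i \<in> space N" if "i \<in> I" for i
        using x that A[OF inv_in[OF that]] sets.sets_into_space by (fastforce simp: PiE_iff)
      ultimately show "x \<in> (\<lambda>x. \<lambda>i\<in>I. x (\<sigma> i)) -` Pi\<^sub>E I A \<inter> space (PiM I (\<lambda>_. N))"
        using x by (auto simp: space_PiM PiE_iff)
    qed
    then have "emeasure (distr (PiM I (\<lambda>_. N)) (PiM I (\<lambda>_. N)) (\<lambda>x. \<lambda>i\<in>I. x (\<sigma> i))) (Pi\<^sub>E I A) =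
        (\<Prod>i\<in>I. emeasure N (A (inv \<sigma> i)))"
      using A inv_in I by (simp add: emeasure_distr sets_PiM_I_finite emeasure_PiM)
    also have "\<dots> = (\<Prod>i\<in>I. emeasure N (A i))"
      using permutes_imp_bij[OF permutes_inv[OF \<sigma>]]
      by (rule prod.reindex_bij_betw)
    finally show "emeasure (distr (PiM I (\<lambda>_. N)) (PiM I (\<lambda>_. N)) (\<lambda>x. \<lambda>i\<in>I. x (\<sigma> i))) (Pi\<^sub>E I A) =
        (\<Prod>i\<in>I. emeasure N (A i))" .
  qed (use I in auto)
qed

section \<open>Sorting the coordinates of almost every point\<close>

lemma product_sigma_finite_lborel: "product_sigma_finite (\<lambda>_. lborel :: real measure)"
  by standard

text \<open>Integrating first over the coordinate \<open>i\<close>, the set of coincidences has the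
  single point \<open>x j\<close> as its slice, which is null.\<close>

lemma AE_PiM_lborel_neq:
  assumes "finite I" "i \<in> I" "j \<in> I" "i \<noteq> j"
  shows "AE x in PiM I (\<lambda>_. lborel :: real measure). x i \<noteq> x j"
proof -
  interpret product_sigma_finite "\<lambda>_. lborel :: real measure"
    by (rule product_sigma_finite_lborel)
  have I: "I = insert i (I - {i})" using assms by auto
  have [measurable]: "{x \<in> space (PiM I (\<lambda>_. lborel :: real measure)). x i = x j} \<in> sets (PiM I (\<lambda>_. lborel))"
    using assms by measurable
  have "emeasure (PiM I (\<lambda>_. lborel)) {x \<in> space (PiM I (\<lambda>_. lborel :: real measure)). x i = x j} =
      (\<integral>\<^sup>+x. indicator {x \<in> space (PiM I (\<lambda>_. lborel :: real measure)). x i = x j} x \<partial>PiM I (\<lambda>_. lborel))"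
    by simp
  also have "\<dots> = (\<integral>\<^sup>+x. indicator {x. x i = x j} x \<partial>PiM I (\<lambda>_. lborel :: real measure))"
    by (intro nn_integral_cong) (simp add: indicator_def)
  also have "\<dots> = (\<integral>\<^sup>+x. indicator {x. x i = x j} x \<partial>PiM (insert i (I - {i})) (\<lambda>_. lborel :: real measure))"
    using I by simp
  also have "\<dots> = (\<integral>\<^sup>+x. (\<integral>\<^sup>+y. indicator {x. x i = x j} (x(i := y)) \<partial>lborel) \<partial>PiM (I - {i}) (\<lambda>_. lborel :: real measure))"
  proof (rule product_nn_integral_insert)
    have "(\<lambda>x. indicator {x. x i = x j} x :: ennreal) \<in> borel_measurable (PiM I (\<lambda>_. lborel :: real measure))"
      by (subst measurable_cong[of _ _ "indicator {x \<in> space (PiM I (\<lambda>_. lborel :: real measure)). x i = x j}"])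
         (auto simp: indicator_def)
    then show "(\<lambda>x. indicator {x. x i = x j} x :: ennreal) \<in> borel_measurable (PiM (insert i (I - {i})) (\<lambda>_. lborel :: real measure))"
      using I by simp
  qed (use assms in auto)
  also have "\<dots> = (\<integral>\<^sup>+x. (\<integral>\<^sup>+y. indicator {x j} y \<partial>lborel) \<partial>PiM (I - {i}) (\<lambda>_. lborel :: real measure))"
    using assms by (intro nn_integral_cong) (auto simp: indicator_def)
  also have "\<dots> = 0" by simp
  finally show ?thesis
    by (subst AE_iff_measurable[OF _ refl]) auto
qed

lemma AE_PiM_lborel_inj_on:
  assumes "finite I"
  shows "AE x in PiM I (\<lambda>_. lborel :: real measure). inj_on x I"
proof -
  have "AE x in PiM I (\<lambda>_. lborel :: real measure). \<forall>i\<in>I. \<forall>j\<in>I. i \<noteq> j \<longrightarrow> x i \<noteq> x j"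
    using assms AE_PiM_lborel_neq[OF assms] by (intro AE_finite_allI AE_impI) auto
  then show ?thesis
    by (rule eventually_mono) (auto simp: inj_on_def)
qed

text \<open>Existence reads the permutation off the sorted list of values. For uniqueness, any
  sorting permutation lists the values as that same list, and injectivity recovers the
  indices.\<close>

lemma ex1_sorting_permutation:
  fixes x :: "nat \<Rightarrow> 'a :: linorder"
  assumes inj: "inj_on x {1..m}"
  shows "\<exists>!\<sigma>. \<sigma> permutes {1..m} \<and> mono_on {1..m} (\<lambda>i. x (\<sigma> i))"
proof (rule ex_ex1I)
  define I where "I = {1..m}"
  define xs where "xs = sorted_list_of_set (x ` I)"
  have len: "length xs = m"
    using inj by (simp add: xs_def I_def card_image)
  \<comment> \<open>List positions start at 0 and coordinates at 1, hence \<open>i - 1\<close>; the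
    identity outside \<open>I\<close> makes this a permutation of \<open>I\<close>.\<close>
  define \<sigma> where "\<sigma> i = (if i \<in> I then inv_into I x (xs ! (i - 1)) else i)" for i
  have "bij_betw (\<lambda>i. i - 1) I {..<m}"
    unfolding I_def by (rule bij_betw_byWitness[of _ Suc]) auto
  moreover have "bij_betw (\<lambda>i. xs ! i) {..<m} (x ` I)"
    using len by (intro bij_betw_nth) (auto simp: xs_def I_def)
  moreover have "bij_betw (inv_into I x) (x ` I) I"
    using inj by (intro bij_betw_inv_into) (auto simp: I_def bij_betw_def)
  ultimately have "bij_betw (inv_into I x \<circ> ((\<lambda>i. xs ! i) \<circ> (\<lambda>i. i - 1))) I I"
    by (intro bij_betw_trans)
  then have "bij_betw \<sigma> I I"
    by (subst bij_betw_cong[where g = "inv_into I x \<circ> ((\<lambda>i. xs ! i) \<circ> (\<lambda>i. i - 1))"]) (auto simp: \<sigma>_def)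
  then have "\<sigma> permutes I"
    by (rule bij_imp_permutes) (auto simp: \<sigma>_def)
  moreover have "x (\<sigma> i) = xs ! (i - 1)" if "i \<in> I" for i
  proof -
    have "xs ! (i - 1) \<in> set xs"
      using that len by (intro nth_mem) (auto simp: I_def)
    then have "xs ! (i - 1) \<in> x ` I"
      by (simp add: xs_def I_def)
    then show ?thesis
      using that by (simp add: \<sigma>_def f_inv_into_f)
  qed
  then have "mono_on I (\<lambda>i. x (\<sigma> i))"
    using len by (auto simp: mono_on_def I_def xs_def intro!: sorted_nth_mono)
  ultimately show "\<exists>\<sigma>. \<sigma> permutes {1..m} \<and> mono_on {1..m} (\<lambda>i. x (\<sigma> i))"
    unfolding I_def by blast
next
  have list: "map (\<lambda>i. x (\<sigma> i)) [1..<Suc m] = sorted_list_of_set (x ` {1..m})"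
    if "\<sigma> permutes {1..m} \<and> mono_on {1..m} (\<lambda>i. x (\<sigma> i))" for \<sigma>
  proof (rule sorted_distinct_set_unique)
    have perm: "\<sigma> permutes {1..m}" and mono: "mono_on {1..m} (\<lambda>i. x (\<sigma> i))"
      using that by auto
    have im: "\<sigma> ` {1..m} = {1..m}"
      using perm by (rule permutes_image)
    show "sorted (map (\<lambda>i. x (\<sigma> i)) [1..<Suc m])"
      using mono unfolding sorted_map
      by (intro sorted_wrt_mono_rel[OF _ sorted_upt]) (auto simp: mono_on_def simp del: upt_Suc)
    have "inj_on (x \<circ> \<sigma>) {1..m}"
      using inj im permutes_inj_on[OF perm] by (intro comp_inj_on) auto
    then show "distinct (map (\<lambda>i. x (\<sigma> i)) [1..<Suc m])"
      by (simp add: distinct_map comp_def atLeastLessThanSuc_atLeastAtMost del: upt_Suc)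
    have "(\<lambda>i. x (\<sigma> i)) ` {1..m} = x ` {1..m}"
      using image_image[of x \<sigma> "{1..m}"] im by simp
    then show "set (map (\<lambda>i. x (\<sigma> i)) [1..<Suc m]) = set (sorted_list_of_set (x ` {1..m}))"
      by (simp add: atLeastLessThanSuc_atLeastAtMost del: upt_Suc)
  qed auto
  fix \<sigma> \<tau>
  assume \<sigma>: "\<sigma> permutes {1..m} \<and> mono_on {1..m} (\<lambda>i. x (\<sigma> i))"
    and \<tau>: "\<tau> permutes {1..m} \<and> mono_on {1..m} (\<lambda>i. x (\<tau> i))"
  show "\<sigma> = \<tau>"
  proof
    fix i
    show "\<sigma> i = \<tau> i"
    proof (cases "i \<in> {1..m}")
      case True
      have "map (\<lambda>i. x (\<sigma> i)) [1..<Suc m] = map (\<lambda>i. x (\<tau> i)) [1..<Suc m]"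
        using list[OF \<sigma>] list[OF \<tau>] by simp
      then have "x (\<sigma> i) = x (\<tau> i)"
        using True by (simp add: map_eq_conv del: upt_Suc)
      moreover have "\<sigma> i \<in> {1..m}" "\<tau> i \<in> {1..m}"
        using True \<sigma> \<tau> by (simp_all add: permutes_in_image del: atLeastAtMost_iff)
      ultimately show ?thesis
        by (rule inj_onD[OF inj])
    next
      case False
      with \<sigma> \<tau> show ?thesis
        using permutes_not_in by metis
    qed
  qed
qed

lemma pred_mono_on [measurable]:
  assumes "finite I"
  shows "Measurable.pred (PiM I (\<lambda>_. lborel :: real measure)) (mono_on I)"
proof -
  have "Measurable.pred (PiM I (\<lambda>_. lborel :: real measure)) (\<lambda>x. x i \<le> x j)" if "i \<in> I" "j \<in> I" for i j
  proof -
    have "(\<lambda>x. x i) \<in> borel_measurable (PiM I (\<lambda>_. lborel :: real measure))"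
      "(\<lambda>x. x j) \<in> borel_measurable (PiM I (\<lambda>_. lborel :: real measure))"
      using that measurable_component_singleton[of _ I "\<lambda>_. lborel :: real measure"] by simp_all
    then show ?thesis
      unfolding pred_def by (rule borel_measurable_le)
  qed
  then have "Measurable.pred (PiM I (\<lambda>_. lborel :: real measure)) (\<lambda>x. \<forall>i\<in>I. \<forall>j\<in>I. i \<le> j \<longrightarrow> x i \<le> x j)"
    using assms by (intro pred_intros_finite pred_intros_logic) simp_all
  then show ?thesis
    by (rule back_subst[of "Measurable.pred _"]) (auto simp: fun_eq_iff mono_on_def)
qed

text \<open>Almost every point is sorted by exactly one permutation, so \<open>F\<close> is almost
  everywhere the sum, over all permutations, of its restriction to sorted points composed with that
  permutation. By invariance of the measure the \<open>fact m\<close> summands have equal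
  integrals.\<close>

lemma nn_integral_PiM_symmetric:
  fixes F :: "(nat \<Rightarrow> real) \<Rightarrow> ennreal" and m :: nat
  defines "P \<equiv> PiM {1..m} (\<lambda>_. lborel :: real measure)"
  assumes [measurable]: "F \<in> borel_measurable P"
    and sym: "\<And>\<sigma> x. \<sigma> permutes {1..m} \<Longrightarrow> F (\<lambda>i\<in>{1..m}. x (\<sigma> i)) = F x"
  shows "integral\<^sup>N P F = fact m * (\<integral>\<^sup>+x. F x * indicator {x. mono_on {1..m} x} x \<partial>P)"
proof -
  define G where "G x = F x * indicator {x. mono_on {1..m} x} x" for x
  have [measurable]: "Measurable.pred P (mono_on {1..m})"
    unfolding P_def by (rule pred_mono_on) simp
  have G [measurable]: "G \<in> borel_measurable P"
    unfolding G_def by measurable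
  define S where "S = {\<sigma>. \<sigma> permutes {1..m}}"
  have S: "finite S" "card S = fact m"
    by (simp_all add: S_def finite_permutations card_permutations)
  define q where "q \<sigma> x = (\<lambda>i\<in>{1..m}. x (\<sigma> i))" for \<sigma> :: "nat \<Rightarrow> nat" and x :: "nat \<Rightarrow> real"
  have [measurable]: "q \<sigma> \<in> P \<rightarrow>\<^sub>M P" if "\<sigma> \<in> S" for \<sigma>
    unfolding P_def q_def using that permutes_in_image[of \<sigma> "{1..m}"]
    by (intro measurable_restrict measurable_component_singleton) (auto simp: S_def)
  have "AE x in P. F x = (\<Sum>\<sigma>\<in>S. G (q \<sigma> x))"
    using AE_PiM_lborel_inj_on[OF finite_atLeastAtMost, of 1 m] unfolding P_def[symmetric]
  proof (rule eventually_mono)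
    fix x :: "nat \<Rightarrow> real" assume "inj_on x {1..m}"
    from ex1_sorting_permutation[OF this] obtain \<tau> where
      \<tau>: "\<tau> permutes {1..m}" "mono_on {1..m} (\<lambda>i. x (\<tau> i))" and
      uniq: "\<And>\<sigma>. \<sigma> permutes {1..m} \<Longrightarrow> mono_on {1..m} (\<lambda>i. x (\<sigma> i)) \<Longrightarrow> \<sigma> = \<tau>"
      by metis
    have mono_q: "mono_on {1..m} (q \<sigma> x) \<longleftrightarrow> mono_on {1..m} (\<lambda>i. x (\<sigma> i))" for \<sigma>
      by (auto simp: mono_on_def q_def)
    have "(\<Sum>\<sigma>\<in>S. G (q \<sigma> x)) = (\<Sum>\<sigma>\<in>S. if \<sigma> = \<tau> then F x else 0)"
    proof (rule sum.cong)
      fix \<sigma> assume "\<sigma> \<in> S"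
      then have "\<sigma> permutes {1..m}" by (simp add: S_def)
      then have "F (q \<sigma> x) = F x"
        unfolding q_def by (rule sym)
      then have "G (q \<sigma> x) = (if mono_on {1..m} (\<lambda>i. x (\<sigma> i)) then F x else 0)"
        unfolding G_def indicator_def mem_Collect_eq mono_q by simp
      moreover have "mono_on {1..m} (\<lambda>i. x (\<sigma> i)) \<longleftrightarrow> \<sigma> = \<tau>"
        using \<tau>(2) uniq[OF \<open>\<sigma> permutes {1..m}\<close>] by blast
      ultimately show "G (q \<sigma> x) = (if \<sigma> = \<tau> then F x else 0)"
        by simp
    qed simp
    also have "\<dots> = F x"
      using \<tau> S by (simp add: S_def)
    finally show "F x = (\<Sum>\<sigma>\<in>S. G (q \<sigma> x))" ..
  qed
  then have "integral\<^sup>N P F = (\<integral>\<^sup>+x. (\<Sum>\<sigma>\<in>S. G (q \<sigma> x)) \<partial>P)"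
    by (rule nn_integral_cong_AE)
  also have "\<dots> = (\<Sum>\<sigma>\<in>S. \<integral>\<^sup>+x. G (q \<sigma> x) \<partial>P)"
    by (intro nn_integral_sum) measurable
  also have "\<dots> = (\<Sum>\<sigma>\<in>S. integral\<^sup>N P G)"
  proof (rule sum.cong)
    fix \<sigma> assume \<sigma>: "\<sigma> \<in> S"
    then have "distr P P (q \<sigma>) = P"
      unfolding P_def q_def[abs_def] S_def
      by (intro distr_PiM_permutes) (auto simp: lborel.sigma_finite_measure_axioms)
    then have "integral\<^sup>N P G = integral\<^sup>N (distr P P (q \<sigma>)) G" by simp
    also have "\<dots> = (\<integral>\<^sup>+x. G (q \<sigma> x) \<partial>P)"
      using \<sigma> by (intro nn_integral_distr) auto
    finally show "(\<integral>\<^sup>+x. G (q \<sigma> x) \<partial>P) = integral\<^sup>N P G" ..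
  qed simp
  also have "\<dots> = fact m * integral\<^sup>N P G"
    by (simp add: S)
  finally show ?thesis
    by (simp add: G_def[abs_def])
qed

text \<open>This is the multinomial theorem in divided powers: after division by factorials the
  binomial theorem becomes a plain convolution, which fits the induction on
  \<open>I\<close>.\<close>

lemma sum_power_div_fact:
  fixes t :: "'b \<Rightarrow> real"
  assumes "finite I"
  shows "(\<Sum>i\<in>I. t i) ^ n / fact n =
    (\<Sum>k\<in>{k \<in> I \<rightarrow>\<^sub>E {0..n}. (\<Sum>i\<in>I. k i) = n}. \<Prod>i\<in>I. t i ^ k i / fact (k i))"
  using assms
proof (induction I arbitrary: n)
  case empty
  then show ?case
    by (cases "n = 0") (auto simp: PiE_empty_domain)
next
  case (insert a I)
  define K where "K J n = {k \<in> J \<rightarrow>\<^sub>E {0..n}. (\<Sum>i\<in>J. k i) = n}" for J :: "'b set" and n :: nat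
  have fin: "finite (K I n)" for n
  proof (rule finite_subset)
    show "K I n \<subseteq> I \<rightarrow>\<^sub>E {0..n}"
      by (auto simp: K_def)
    show "finite (I \<rightarrow>\<^sub>E {0..n})"
      using insert.hyps by (intro finite_PiE) simp_all
  qed
  have "(\<Sum>i\<in>insert a I. t i) ^ n / fact n = (t a + (\<Sum>i\<in>I. t i)) ^ n / fact n"
    using insert.hyps by simp
  also have "\<dots> = (\<Sum>j\<le>n. t a ^ j / fact j * ((\<Sum>i\<in>I. t i) ^ (n - j) / fact (n - j)))"
    unfolding binomial_ring sum_divide_distrib
  proof (rule sum.cong)
    fix j assume "j \<in> {..n}"
    then have "real (n choose j) = fact n / (fact j * fact (n - j))"
      by (intro binomial_fact) simp
    then show "of_nat (n choose j) * t a ^ j * (\<Sum>i\<in>I. t i) ^ (n - j) / fact n =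
        t a ^ j / fact j * ((\<Sum>i\<in>I. t i) ^ (n - j) / fact (n - j))"
      by simp
  qed simp
  also have "\<dots> = (\<Sum>j\<le>n. \<Sum>k\<in>K I (n - j). t a ^ j / fact j * (\<Prod>i\<in>I. t i ^ k i / fact (k i)))"
    unfolding insert.IH K_def by (simp add: sum_distrib_left)
  also have "\<dots> = (\<Sum>(j, k)\<in>(SIGMA j:{..n}. K I (n - j)). t a ^ j / fact j * (\<Prod>i\<in>I. t i ^ k i / fact (k i)))"
    using fin by (intro sum.Sigma) auto
  also have "\<dots> = (\<Sum>k\<in>K (insert a I) n. \<Prod>i\<in>insert a I. t i ^ k i / fact (k i))"
  \<comment> \<open>A multi-index on \<open>insert a I\<close> corresponds to its value at
    \<open>a\<close> and its restriction to \<open>I\<close>; resetting \<open>a\<close> to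
    \<open>undefined\<close> keeps the restriction extensional.\<close>
  proof (rule sum.reindex_bij_witness[of _ "\<lambda>k. (k a, k(a := undefined))" "\<lambda>(j, k). k(a := j)"])
    fix jk assume "jk \<in> (SIGMA j:{..n}. K I (n - j))"
    then obtain j k where jk: "jk = (j, k)" "j \<le> n" "k \<in> I \<rightarrow>\<^sub>E {0..n - j}" "(\<Sum>i\<in>I. k i) = n - j"
      by (auto simp: K_def)
    have upd: "(\<Sum>i\<in>I. (k(a := j)) i) = (\<Sum>i\<in>I. k i)"
        "(\<Prod>i\<in>I. t i ^ (k(a := j)) i / fact ((k(a := j)) i)) = (\<Prod>i\<in>I. t i ^ k i / fact (k i))"
      using insert.hyps by (auto intro!: sum.cong prod.cong)
    have "k a = undefined" 
      using jk(3) insert.hyps by (auto simp: PiE_iff extensional_def)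
    then show "(\<lambda>k. (k a, k(a := undefined))) ((\<lambda>(j, k). k(a := j)) jk) = jk"
      using jk by (auto simp: fun_eq_iff)
    have "k i \<le> n" if "i \<in> I" for i
      using PiE_mem[OF jk(3) that] by simp
    then have "k(a := j) \<in> insert a I \<rightarrow>\<^sub>E {0..n}"
      using jk(2,3) by (simp add: PiE_iff extensional_def)
    then show "(\<lambda>(j, k). k(a := j)) jk \<in> K (insert a I) n"
      using jk insert.hyps upd by (simp add: K_def)
    show "(\<Prod>i\<in>insert a I. t i ^ (\<lambda>(j, k). k(a := j)) jk i / fact ((\<lambda>(j, k). k(a := j)) jk i)) =
        (\<lambda>(j, k). t a ^ j / fact j * (\<Prod>i\<in>I. t i ^ k i / fact (k i))) jk"
      using insert.hyps upd jk by simp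
  next
    fix k assume k: "k \<in> K (insert a I) n"
    then have sum: "k a + (\<Sum>i\<in>I. k i) = n"
      using insert.hyps by (simp add: K_def)
    have upd: "(\<Sum>i\<in>I. (k(a := undefined)) i) = (\<Sum>i\<in>I. k i)"
      using insert.hyps by (auto intro!: sum.cong)
    have "k i \<le> n - k a" if "i \<in> I" for i
      using member_le_sum[of i I k] that insert.hyps sum by simp
    then have "k(a := undefined) \<in> I \<rightarrow>\<^sub>E {0..n - k a}"
      using k insert.hyps by (auto simp: K_def PiE_iff extensional_def)
    then show "(k a, k(a := undefined)) \<in> (SIGMA j:{..n}. K I (n - j))"
      using sum upd by (auto simp: K_def)
  qed auto
  finally show ?case
    by (simp add: K_def)
qed

subsection \<open>Integration over a chamber\<close>

text \<open>Bounding only the two end coordinates lets a new largest coordinate be added with the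
  sole condition that it lie between \<open>x m\<close> and 1.\<close>

definition chamber :: "nat \<Rightarrow> (nat \<Rightarrow> real) set" where
  "chamber m = {x. mono_on {1..m} x \<and> 0 \<le> x 1 \<and> x m \<le> 1 \<and> 1 \<le> x 1 + x 2}"

text \<open>The last bound holds because \<open>x m\<close> dominates \<open>x 1\<close> and
  \<open>x 2\<close>, whose sum is at least 1. It keeps the lower limit of the next integration away
  from 0.\<close>

lemma chamberD:
  assumes "x \<in> chamber m" "m \<ge> 2"
  shows "\<And>i. i \<in> {1..m} \<Longrightarrow> 0 \<le> x i" "\<And>i. i \<in> {1..m} \<Longrightarrow> x i \<le> 1" "1/2 \<le> x m"
proof -
  have mono: "x i \<le> x j" if "i \<in> {1..m}" "j \<in> {1..m}" "i \<le> j" for i j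
    using assms that by (auto simp: chamber_def mono_on_def)
  show "0 \<le> x i" "x i \<le> 1" if "i \<in> {1..m}" for i
    using mono[of 1 i] mono[of i m] that assms by (auto simp: chamber_def)
  show "1/2 \<le> x m"
    using mono[of 1 m] mono[of 2 m] assms by (auto simp: chamber_def)
qed

text \<open>In a sorted point \<open>x 1\<close> and \<open>x 2\<close> are the two smallest
  coordinates, so their condition implies that of every other pair.\<close>

lemma chamber_eq_W_Int_mono:
  assumes "m \<ge> 2"
  shows "chamber m = W m \<inter> {x. mono_on {1..m} x}"
proof (intro set_eqI iffI)
  fix x assume x: "x \<in> chamber m"
  have "1 \<le> x i + x j" if "i \<in> {1..m}" "j \<in> {1..m}" "i < j" for i j
  proof -
    have "x 1 \<le> x i" "x 2 \<le> x j" "1 \<le> x 1 + x 2"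
      using x that assms by (auto simp: chamber_def mono_on_def)
    then show ?thesis by linarith
  qed
  with chamberD[OF x assms] x show "x \<in> W m \<inter> {x. mono_on {1..m} x}"
    by (simp add: W_def chamber_def)
qed (use assms in \<open>auto simp: chamber_def W_def\<close>)

lemma measurable_chamber [measurable]:
  assumes "m \<ge> 2"
  shows "Measurable.pred (PiM {1..m} (\<lambda>_. lborel :: real measure)) (\<lambda>x. x \<in> chamber m)"
proof -
  have c: "(\<lambda>x. x i) \<in> borel_measurable (PiM {1..m} (\<lambda>_. lborel :: real measure))" if "i \<in> {1..m}" for i
    using that measurable_component_singleton[of i "{1..m}" "\<lambda>_. lborel :: real measure"] by simp
  have [measurable]: "(\<lambda>x. x 1) \<in> borel_measurable (PiM {1..m} (\<lambda>_. lborel :: real measure))"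
    "(\<lambda>x. x 2) \<in> borel_measurable (PiM {1..m} (\<lambda>_. lborel :: real measure))"
    "(\<lambda>x. x m) \<in> borel_measurable (PiM {1..m} (\<lambda>_. lborel :: real measure))"
    "Measurable.pred (PiM {1..m} (\<lambda>_. lborel :: real measure)) (mono_on {1..m})"
    using assms by (simp_all only: c pred_mono_on finite_atLeastAtMost) (simp_all add: c)
  show ?thesis
    unfolding chamber_def mem_Collect_eq by measurable
qed

text \<open>The exponent \<open>e\<close> collects the powers of \<open>- ln\<close> left behind by the variables above \<open>x m\<close> that
  have been integrated out.\<close>

definition chamber_integral :: "nat \<Rightarrow> (nat \<Rightarrow> nat) \<Rightarrow> nat \<Rightarrow> ennreal" where
  "chamber_integral m k e = (\<integral>\<^sup>+x. ennreal ((\<Prod>i\<in>{1..m}. (- ln (x i)) ^ k i / x i) * (- ln (x m)) ^ e) *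
      indicator (chamber m) x \<partial>PiM {1..m} (\<lambda>_. lborel))"

lemma measurable_chamber_integrand [measurable]:
  assumes "m \<ge> 2"
  shows "(\<lambda>x. ennreal ((\<Prod>i\<in>{1..m}. (- ln (x i)) ^ k i / x i) * (- ln (x m)) ^ e) *
      indicator (chamber m) x) \<in> borel_measurable (PiM {1..m} (\<lambda>_. lborel :: real measure))"
proof -
  have c: "(\<lambda>x. x i) \<in> borel_measurable (PiM {1..m} (\<lambda>_. lborel :: real measure))" if "i \<in> {1..m}" for i
    using that measurable_component_singleton[of i "{1..m}" "\<lambda>_. lborel :: real measure"] by simp
  have [measurable]: "(\<lambda>x. \<Prod>i\<in>{1..m}. (- ln (x i)) ^ k i / x i) \<in> borel_measurable (PiM {1..m} (\<lambda>_. lborel :: real measure))"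
  proof (rule borel_measurable_prod)
    fix i assume "i \<in> {1..m}"
    note [measurable] = c[OF this]
    show "(\<lambda>x. (- ln (x i)) ^ k i / x i) \<in> borel_measurable (PiM {1..m} (\<lambda>_. lborel :: real measure))"
      by measurable
  qed
  have [measurable]: "(\<lambda>x. x m) \<in> borel_measurable (PiM {1..m} (\<lambda>_. lborel :: real measure))"
    using assms by (intro c) simp
  note [measurable] = measurable_chamber[OF assms]
  show ?thesis
    by measurable
qed

lemma prod_ln_power_nonneg:
  assumes "x \<in> chamber m" "m \<ge> 2"
  shows "0 \<le> (\<Prod>i\<in>{1..m}. (- ln (x i)) ^ k i / x i)"
proof (intro prod_nonneg divide_nonneg_nonneg zero_le_power ballI)
  fix i assume "i \<in> {1..m}"
  \<comment> \<open>A coordinate may be 0; there \<open>ln\<close> takes its default value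
    0.\<close>
  from chamberD(1,2)[OF assms this] show "0 \<le> x i" "0 \<le> - ln (x i)"
    by (auto simp: le_less)
qed

text \<open>The largest variable is integrated out over \<open>{x m..1}\<close>. The upper limit
  contributes nothing, and the lower one raises the power of \<open>- ln (x m)\<close> by
  \<open>k (Suc m) + e + 1\<close>, which becomes the new exponent and the new denominator.\<close>

lemma chamber_integral_Suc:
  assumes "m \<ge> 2"
  shows "chamber_integral (Suc m) k e =
    ennreal (1 / real (k (Suc m) + e + 1)) * chamber_integral m k (k (Suc m) + e + 1)"
proof -
  interpret product_sigma_finite "\<lambda>_. lborel :: real measure"
    by (rule product_sigma_finite_lborel)
  define P where "P x = (\<Prod>i\<in>{1..m}. (- ln (x i)) ^ k i / x i)" for x :: "nat \<Rightarrow> real"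
  let ?f = "\<lambda>x. ennreal ((\<Prod>i\<in>{1..Suc m}. (- ln (x i)) ^ k i / x i) * (- ln (x (Suc m))) ^ e) *
      indicator (chamber (Suc m)) x"
  have ins: "{1..Suc m} = insert (Suc m) {1..m}" by auto
  have inner: "(\<integral>\<^sup>+y. ?f (x(Suc m := y)) \<partial>lborel) =
      ennreal (1 / real (k (Suc m) + e + 1)) * (ennreal (P x * (- ln (x m)) ^ (k (Suc m) + e + 1)) * indicator (chamber m) x)" for x
  proof -
    have mono: "mono_on {1..Suc m} (x(Suc m := y)) \<longleftrightarrow> mono_on {1..m} x \<and> x m \<le> y" for y
    proof
      assume "mono_on {1..Suc m} (x(Suc m := y))"
      then have *: "(x(Suc m := y)) i \<le> (x(Suc m := y)) j" if "1 \<le> i" "i \<le> j" "j \<le> Suc m" for i j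
        using that by (auto simp: mono_on_def)
      have "x i \<le> x j" if "1 \<le> i" "i \<le> j" "j \<le> m" for i j
        using *[of i j] that by auto
      moreover have "x m \<le> y"
        using *[of m "Suc m"] assms by auto
      ultimately show "mono_on {1..m} x \<and> x m \<le> y"
        by (auto simp: mono_on_def)
    next
      assume *: "mono_on {1..m} x \<and> x m \<le> y"
      then have "x i \<le> y" if "1 \<le> i" "i \<le> m" for i
        using that assms by (intro order_trans[of "x i" "x m" y]) (auto simp: mono_on_def)
      with * show "mono_on {1..Suc m} (x(Suc m := y))"
        by (auto simp: mono_on_def le_Suc_eq)
    qed
    have chamber: "x(Suc m := y) \<in> chamber (Suc m) \<longleftrightarrow> x \<in> chamber m \<and> y \<in> {x m..1}" for y
      using assms unfolding chamber_def mem_Collect_eq mono by auto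
    show ?thesis
    proof (cases "x \<in> chamber m")
      case True
      note x = chamberD[OF True assms] prod_ln_power_nonneg[OF True assms, of k, folded P_def]
      have "m \<in> {1..m}" using assms by simp
      have "(\<integral>\<^sup>+y. ?f (x(Suc m := y)) \<partial>lborel) =
          (\<integral>\<^sup>+y. ennreal (P x) * (ennreal ((- ln y) ^ (k (Suc m) + e) / y) * indicator {x m..1} y) \<partial>lborel)"
      proof (rule nn_integral_cong)
        fix y
        have "(\<Prod>i\<in>{1..m}. (- ln ((x(Suc m := y)) i)) ^ k i / (x(Suc m := y)) i) = P x"
          unfolding P_def by (intro prod.cong) auto
        then have "(\<Prod>i\<in>{1..Suc m}. (- ln ((x(Suc m := y)) i)) ^ k i / (x(Suc m := y)) i) * (- ln ((x(Suc m := y)) (Suc m))) ^ e =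
            P x * ((- ln y) ^ (k (Suc m) + e) / y)"
          unfolding ins by (simp add: power_add mult_ac)
        then show "?f (x(Suc m := y)) = ennreal (P x) * (ennreal ((- ln y) ^ (k (Suc m) + e) / y) * indicator {x m..1} y)"
          using True x(4) by (simp add: chamber indicator_def del: prod.cl_ivl_Suc fun_upd_apply flip: ennreal_mult')
      qed
      also have "\<dots> = ennreal (P x) * ennreal ((- ln (x m)) ^ Suc (k (Suc m) + e) / real (Suc (k (Suc m) + e)))"
        using x(2)[OF \<open>m \<in> {1..m}\<close>] x(3)
        by (simp add: nn_integral_cmult nn_integral_ln_power_over_x del: power_Suc of_nat_Suc)
      also have "\<dots> = ennreal (1 / real (k (Suc m) + e + 1)) * ennreal (P x * (- ln (x m)) ^ (k (Suc m) + e + 1))"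
        using x(4) by (simp flip: ennreal_mult' del: power_Suc of_nat_Suc)
      finally show ?thesis
        using True by simp
    qed (simp add: chamber)
  qed
  have "chamber_integral (Suc m) k e = (\<integral>\<^sup>+x. (\<integral>\<^sup>+y. ?f (x(Suc m := y)) \<partial>lborel) \<partial>PiM {1..m} (\<lambda>_. lborel))"
    unfolding chamber_integral_def ins
  proof (rule product_nn_integral_insert)
    show "(\<lambda>x. ennreal ((\<Prod>i\<in>insert (Suc m) {1..m}. (- ln (x i)) ^ k i / x i) * (- ln (x (Suc m))) ^ e) *
      indicator (chamber (Suc m)) x) \<in> borel_measurable (PiM (insert (Suc m) {1..m}) (\<lambda>_. lborel :: real measure))"
      using measurable_chamber_integrand[of "Suc m" k e] assms unfolding ins by simp
  qed auto
  also have "\<dots> = ennreal (1 / real (k (Suc m) + e + 1)) * chamber_integral m k (k (Suc m) + e + 1)"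
    unfolding inner chamber_integral_def P_def
    using assms by (intro nn_integral_cmult measurable_chamber_integrand)
  finally show ?thesis .
qed

text \<open>For \<open>x 2 = z\<close> in \<open>{1/2..1}\<close> the variable \<open>x 1\<close>
  runs over \<open>{1 - z..z}\<close>. Its integral has denominator \<open>k 1 + 1\<close>, whereas
  \<open>wedge_value\<close> divides by \<open>fact (k 1 + 1)\<close>; this explains the factor
  \<open>fact (k 1)\<close>.\<close>

lemma chamber_integral_2:
  "chamber_integral 2 k e = ennreal (fact (k 1) * wedge_value (k 2 + e) (k 1))"
proof -
  interpret product_sigma_finite "\<lambda>_. lborel :: real measure"
    by (rule product_sigma_finite_lborel)
  define S where "S = k 2 + e"
  define f :: "real \<Rightarrow> real \<Rightarrow> ennreal" where
    "f z y = ennreal ((- ln z) ^ S / z) * indicator {1/2..1} z * (ennreal ((- ln y) ^ k 1 / y) * (if 1 - z \<le> y \<and> y \<le> z then 1 else 0))" for z y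
  have [measurable]: "case_prod f \<in> borel_measurable (lborel \<Otimes>\<^sub>M lborel)"
    unfolding f_def by measurable
  \<comment> \<open>Listing 2 first makes \<open>x 2\<close> the outer variable of
    integration.\<close>
  have set2: "{1..2} = {2, 1::nat}" by auto
  have "chamber_integral 2 k e = (\<integral>\<^sup>+x. f (x 2) (x 1) \<partial>PiM {2, 1::nat} (\<lambda>_. lborel))"
    unfolding chamber_integral_def set2
  proof (rule nn_integral_cong)
    fix x :: "nat \<Rightarrow> real"
    have "x \<in> chamber 2 \<longleftrightarrow> x 2 \<in> {1/2..1} \<and> 1 - x 2 \<le> x 1 \<and> x 1 \<le> x 2"
    proof -
      have "mono_on {1..2} x \<longleftrightarrow> x 1 \<le> x 2"
        unfolding set2 mono_on_def by auto
      then show ?thesis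
        by (auto simp: chamber_def)
    qed
    moreover have "0 \<le> (- ln z) ^ S / z" if "z \<in> {1/2..1}" for z :: real
      using that by (intro divide_nonneg_nonneg zero_le_power) auto
    moreover have "(\<Prod>i\<in>{2, 1}. (- ln (x i)) ^ k i / x i) * (- ln (x 2)) ^ e =
        (- ln (x 2)) ^ S / x 2 * ((- ln (x 1)) ^ k 1 / x 1)"
      by (simp add: S_def power_add mult_ac)
    ultimately show "ennreal ((\<Prod>i\<in>{2, 1}. (- ln (x i)) ^ k i / x i) * (- ln (x 2)) ^ e) * indicator (chamber 2) x = f (x 2) (x 1)"
      unfolding f_def indicator_def
      by (cases "x 2 \<in> {1/2..1}"; cases "1 - x 2 \<le> x 1 \<and> x 1 \<le> x 2")
         (simp_all only: ennreal_mult' of_bool_eq mult_1_right mult_zero_right mult_zero_left if_True if_False simp_thms)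
  qed
  also have "\<dots> = (\<integral>\<^sup>+z. f (fst z) (snd z) \<partial>(lborel \<Otimes>\<^sub>M lborel))"
    by (rule product_nn_integral_pair) simp_all
  also have "\<dots> = (\<integral>\<^sup>+z. (\<integral>\<^sup>+y. f z y \<partial>lborel) \<partial>lborel)"
    by (subst lborel.nn_integral_fst[symmetric]) (simp_all add: case_prod_beta')
  also have "\<dots> = (\<integral>\<^sup>+z. ennreal (fact (k 1)) * (ennreal ((- ln z) ^ S / z * (((- ln (1 - z)) ^ Suc (k 1) - (- ln z) ^ Suc (k 1)) / fact (Suc (k 1)))) *
      indicator {1/2..1} z) \<partial>lborel)"
  proof (rule nn_integral_cong_AE)
    have "(\<integral>\<^sup>+y. f z y \<partial>lborel) = ennreal (fact (k 1)) * (ennreal ((- ln z) ^ S / z * (((- ln (1 - z)) ^ Suc (k 1) - (- ln z) ^ Suc (k 1)) / fact (Suc (k 1)))) *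
      indicator {1/2..1} z)" if "z \<noteq> 1" for z
    proof (cases "z \<in> {1/2..1}")
      case True
      with that have z: "1/2 \<le> z" "z < 1" by auto
      have "0 \<le> (- ln z) ^ S / z"
        using z by (intro divide_nonneg_nonneg zero_le_power) auto
      have "(\<integral>\<^sup>+y. f z y \<partial>lborel) = (\<integral>\<^sup>+y. ennreal ((- ln z) ^ S / z) * (ennreal ((- ln y) ^ k 1 / y) * indicator {1 - z..z} y) \<partial>lborel)"
        using True by (intro nn_integral_cong) (simp add: f_def indicator_def)
      also have "\<dots> = ennreal ((- ln z) ^ S / z) * ennreal (((- ln (1 - z)) ^ Suc (k 1) - (- ln z) ^ Suc (k 1)) / real (Suc (k 1)))"
        using z by (simp add: nn_integral_cmult nn_integral_ln_power_over_x del: power_Suc of_nat_Suc)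
      also have "\<dots> = ennreal (fact (k 1)) * ennreal ((- ln z) ^ S / z * (((- ln (1 - z)) ^ Suc (k 1) - (- ln z) ^ Suc (k 1)) / fact (Suc (k 1))))"
        using \<open>0 \<le> (- ln z) ^ S / z\<close> by (simp add: mult_ac flip: ennreal_mult' del: power_Suc of_nat_Suc)
      finally show ?thesis
        using True by simp
    qed (simp add: f_def)
    then show "AE z in lborel. (\<integral>\<^sup>+y. f z y \<partial>lborel) = ennreal (fact (k 1)) * (ennreal ((- ln z) ^ S / z * (((- ln (1 - z)) ^ Suc (k 1) - (- ln z) ^ Suc (k 1)) / fact (Suc (k 1)))) *
      indicator {1/2..1} z)"
      using AE_lborel_singleton[of "1::real"] by (auto elim: eventually_mono)
  qed
  also have "\<dots> = ennreal (fact (k 1)) * ennreal (wedge_value S (k 1))"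
    unfolding nn_integral_wedge[symmetric] by (rule nn_integral_cmult) simp
  also have "\<dots> = ennreal (fact (k 1) * wedge_value (k 2 + e) (k 1))"
    by (simp add: S_def ennreal_mult')
  finally show ?thesis .
qed

text \<open>Induction removes the largest variable each time. The exponent \<open>e\<close> has to
  stay general since it accumulates; at \<open>e = 0\<close> the product consists of the
  denominators in \<open>Acoef\<close>.\<close>

lemma chamber_integral_eq:
  assumes "m \<ge> 2"
  shows "chamber_integral m k e = ennreal ((\<Prod>j\<in>{3..m}. 1 / real ((\<Sum>i\<in>{j..m}. k i) + (m - j + 1) + e)) *
      fact (k 1) * wedge_value ((\<Sum>i\<in>{2..m}. k i) + (m - 2) + e) (k 1))"
  using assms
proof (induction m arbitrary: e rule: dec_induct)
  case base
  then show ?case by (simp add: chamber_integral_2)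
next
  case (step m)
  define e' where "e' = k (Suc m) + e + 1"
  \<comment> \<open>The accumulated exponent \<open>e'\<close> supplies exactly the summand
    \<open>k (Suc m)\<close> and the additional 1 by which the denominators for \<open>Suc m\<close>
    exceed those for \<open>m\<close>.\<close>
  have sum_eq: "(\<Sum>i\<in>{j..m}. k i) + (m - j + 1) + e' = (\<Sum>i\<in>{j..Suc m}. k i) + (Suc m - j + 1) + e"
    if "j \<in> {3..m}" for j
    using that by (simp add: e'_def Suc_diff_le)
  have S_eq: "(\<Sum>i\<in>{2..m}. k i) + (m - 2) + e' = (\<Sum>i\<in>{2..Suc m}. k i) + (Suc m - 2) + e"
    using step.hyps by (simp add: e'_def)
  have "{3..Suc m} = insert (Suc m) {3..m}"
    using step.hyps by auto
  then have "(\<Prod>j\<in>{3..Suc m}. 1 / real ((\<Sum>i\<in>{j..Suc m}. k i) + (Suc m - j + 1) + e)) =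
      1 / real e' * (\<Prod>j\<in>{3..m}. 1 / real ((\<Sum>i\<in>{j..Suc m}. k i) + (Suc m - j + 1) + e))"
    by (simp add: e'_def add_ac)
  also have "(\<Prod>j\<in>{3..m}. 1 / real ((\<Sum>i\<in>{j..Suc m}. k i) + (Suc m - j + 1) + e)) =
      (\<Prod>j\<in>{3..m}. 1 / real ((\<Sum>i\<in>{j..m}. k i) + (m - j + 1) + e'))"
    by (intro prod.cong) (simp_all only: sum_eq)
  finally show ?case
    unfolding chamber_integral_Suc[OF step.hyps(1)] e'_def[symmetric] step.IH S_eq
    by (simp add: mult.assoc flip: ennreal_mult')
qed

subsection \<open>Membership in the polynomial ring\<close>

lemma rat_poly_ring_uminus: "x \<in> rat_poly_ring V \<Longrightarrow> - x \<in> rat_poly_ring V"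
  using rat_poly_ring.mult[OF rat_poly_ring.rat[of "-1"]] by fastforce

lemma rat_poly_ring_diff: "x \<in> rat_poly_ring V \<Longrightarrow> y \<in> rat_poly_ring V \<Longrightarrow> x - y \<in> rat_poly_ring V"
  using rat_poly_ring.add[OF _ rat_poly_ring_uminus] by fastforce

lemma rat_poly_ring_Rats: "x \<in> \<rat> \<Longrightarrow> x \<in> rat_poly_ring V"
  by (auto elim: Rats_cases intro: rat_poly_ring.rat)

lemma rat_poly_ring_sum: "(\<And>i. i \<in> I \<Longrightarrow> f i \<in> rat_poly_ring V) \<Longrightarrow> sum f I \<in> rat_poly_ring V"
  by (induction I rule: infinite_finite_induct)
     (auto intro: rat_poly_ring.add rat_poly_ring_Rats)

lemma rat_poly_ring_power: "x \<in> rat_poly_ring V \<Longrightarrow> x ^ n \<in> rat_poly_ring V"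
  by (induction n) (auto intro: rat_poly_ring.mult rat_poly_ring_Rats)

lemma rat_poly_ring_divide_Rats: "x \<in> rat_poly_ring V \<Longrightarrow> y \<in> \<rat> \<Longrightarrow> x / y \<in> rat_poly_ring V"
  using rat_poly_ring.mult[OF _ rat_poly_ring_Rats[of "inverse y"]] by (simp add: divide_inverse)

lemma fact_in_Rats: "fact n \<in> (\<rat> :: real set)"
  by (metis of_nat_fact Rats_of_nat)

lemma Acoef_in_Rats: "Acoef m k \<in> \<rat>"
  unfolding Acoef_def by (intro Rats_divide Rats_1 Rats_prod fact_in_Rats Rats_of_nat)

lemma wedge_value_in_rat_poly_ring:
  assumes "ln 2 \<in> rat_poly_ring V" "mzv ((S + 2) # replicate k 1) \<in> rat_poly_ring V"
    and "\<And>p. p \<le> S \<Longrightarrow> mpl ((S + 2 - p) # replicate k 1) (1/2) \<in> rat_poly_ring V"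
  shows "wedge_value S k \<in> rat_poly_ring V"
  unfolding wedge_value_def using assms
  by (intro rat_poly_ring_diff rat_poly_ring.mult rat_poly_ring_sum rat_poly_ring_divide_Rats
      rat_poly_ring_power rat_poly_ring_Rats[OF fact_in_Rats] Rats_mult fact_in_Rats Rats_of_nat) auto

subsection \<open>Evaluation of the integral\<close>

definition M_integrand :: "nat \<Rightarrow> nat \<Rightarrow> (nat \<Rightarrow> real) \<Rightarrow> ennreal" where
  "M_integrand m n x = indicator (W m) x *
      ennreal ((- ln (\<Prod>i\<in>{1..m}. x i)) ^ n / (\<Prod>i\<in>{1..m}. x i))"

lemma measurable_M_integrand:
  "M_integrand m n \<in> borel_measurable (PiM {1..m} (\<lambda>_. lborel))"
proof -
  have c: "(\<lambda>x. x i) \<in> borel_measurable (PiM {1..m} (\<lambda>_. lborel :: real measure))" if "i \<in> {1..m}" for i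
    using that measurable_component_singleton[of i "{1..m}" "\<lambda>_. lborel :: real measure"] by simp
  have [measurable]: "(\<lambda>x. \<Prod>i\<in>{1..m}. x i) \<in> borel_measurable (PiM {1..m} (\<lambda>_. lborel :: real measure))"
    by (intro borel_measurable_prod c)
  have "Measurable.pred (PiM {1..m} (\<lambda>_. lborel :: real measure)) (\<lambda>x. 0 \<le> x i \<and> x i \<le> 1)" if "i \<in> {1..m}" for i
  proof -
    note [measurable] = c[OF that]
    show ?thesis by measurable
  qed
  moreover have "Measurable.pred (PiM {1..m} (\<lambda>_. lborel :: real measure)) (\<lambda>x. 1 \<le> x i + x j)" if "i \<in> {1..m}" "j \<in> {1..m}" for i j
  proof -
    note [measurable] = c[OF that(1)] c[OF that(2)]
    show ?thesis by measurable
  qed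
  ultimately have [measurable]: "Measurable.pred (PiM {1..m} (\<lambda>_. lborel :: real measure)) (\<lambda>x. x \<in> W m)"
    unfolding W_def mem_Collect_eq
    by (intro pred_intros_logic pred_intros_finite) simp_all
  show ?thesis
    unfolding M_integrand_def[abs_def] by measurable
qed

lemma W_permute:
  assumes "\<sigma> permutes {1..m}"
  shows "(\<lambda>i\<in>{1..m}. x (\<sigma> i)) \<in> W m \<longleftrightarrow> x \<in> W m"
proof -
  \<comment> \<open>Replacing \<open>i < j\<close> by \<open>i \<noteq> j\<close> gives a condition
    that is visibly invariant under permutations.\<close>
  have W_iff: "y \<in> W m \<longleftrightarrow> (\<forall>i\<in>{1..m}. 0 \<le> y i \<and> y i \<le> 1) \<and> (\<forall>i\<in>{1..m}. \<forall>j\<in>{1..m}. i \<noteq> j \<longrightarrow> 1 \<le> y i + y j)" for y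
    unfolding W_def by (force simp: neq_iff add.commute)
  have im: "\<sigma> ` {1..m} = {1..m}"
    using assms by (rule permutes_image)
  have "(\<forall>i\<in>{1..m}. 0 \<le> x (\<sigma> i) \<and> x (\<sigma> i) \<le> 1) \<longleftrightarrow> (\<forall>i\<in>\<sigma> ` {1..m}. 0 \<le> x i \<and> x i \<le> 1)"
    by (simp only: ball_simps)
  moreover have "(\<forall>i\<in>{1..m}. \<forall>j\<in>{1..m}. i \<noteq> j \<longrightarrow> 1 \<le> x (\<sigma> i) + x (\<sigma> j)) \<longleftrightarrow>
      (\<forall>i\<in>\<sigma> ` {1..m}. \<forall>j\<in>\<sigma> ` {1..m}. i \<noteq> j \<longrightarrow> 1 \<le> x i + x j)"
    using permutes_inj[OF assms] by (simp only: ball_simps inj_eq)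
  ultimately show ?thesis
    unfolding im by (simp add: W_iff del: atLeastAtMost_iff)
qed

lemma M_integrand_permute:
  assumes "\<sigma> permutes {1..m}"
  shows "M_integrand m n (\<lambda>i\<in>{1..m}. x (\<sigma> i)) = M_integrand m n x"
proof -
  have "(\<Prod>i\<in>{1..m}. (\<lambda>i\<in>{1..m}. x (\<sigma> i)) i) = (\<Prod>i\<in>{1..m}. x (\<sigma> i))"
    by (intro prod.cong) auto
  also have "\<dots> = (\<Prod>i\<in>{1..m}. x i)"
    using permutes_imp_bij[OF assms] by (rule prod.reindex_bij_betw)
  finally show ?thesis
    by (simp only: M_integrand_def indicator_def W_permute[OF assms])
qed

text \<open>Extensionality fixes the values outside \<open>{1..m}\<close>, so each tuple is counted
  once.\<close>

definition compositions :: "nat \<Rightarrow> nat \<Rightarrow> (nat \<Rightarrow> nat) set" where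
  "compositions m n = {k \<in> {1..m} \<rightarrow>\<^sub>E {0..n}. (\<Sum>i\<in>{1..m}. k i) = n}"

lemma finite_compositions: "finite (compositions m n)"
proof (rule finite_subset)
  show "compositions m n \<subseteq> {1..m} \<rightarrow>\<^sub>E {0..n}"
    by (auto simp: compositions_def)
  show "finite ({1..m} \<rightarrow>\<^sub>E {0..n})"
    by (intro finite_PiE) simp_all
qed

text \<open>If some \<open>x i\<close> is \<open>0\<close>, both sides are \<open>0\<close> because division by zero yields \<open>0\<close>.\<close>

lemma ln_prod_power_div_prod:
  fixes x :: "nat \<Rightarrow> real"
  assumes "\<And>i. i \<in> {1..m} \<Longrightarrow> 0 \<le> x i"
  shows "(- ln (\<Prod>i\<in>{1..m}. x i)) ^ n / (\<Prod>i\<in>{1..m}. x i) =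
    (\<Sum>k\<in>compositions m n. fact n / (\<Prod>i\<in>{1..m}. fact (k i)) * (\<Prod>i\<in>{1..m}. (- ln (x i)) ^ k i / x i))"
proof (cases "\<exists>i\<in>{1..m}. x i = 0")
  case True
  then have "(\<Prod>i\<in>{1..m}. x i) = 0" by auto
  moreover have "(\<Prod>i\<in>{1..m}. (- ln (x i)) ^ k i / x i) = 0" for k
    using True by (intro prod_zero) auto
  ultimately show ?thesis by (simp only: div_by_0 mult_zero_right sum.neutral_const)
next
  case False
  then have "- ln (\<Prod>i\<in>{1..m}. x i) = (\<Sum>i\<in>{1..m}. - ln (x i))"
    using assms by (subst ln_prod) (force simp: sum_negf less_le)+
  then have "(- ln (\<Prod>i\<in>{1..m}. x i)) ^ n = fact n * (\<Sum>k\<in>compositions m n. \<Prod>i\<in>{1..m}. (- ln (x i)) ^ k i / fact (k i))"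
    using sum_power_div_fact[of "{1..m}" "\<lambda>i. - ln (x i)" n] by (simp add: compositions_def field_simps del: One_nat_def)
  then show ?thesis
    by (simp add: sum_distrib_left sum_divide_distrib prod_dividef)
qed

text \<open>Symmetry reduces the integral to the chamber, where the multinomial expansion has
  nonnegative terms and therefore passes through \<open>ennreal\<close> and the integral.\<close>

lemma M_eq_sum_chamber_integral:
  assumes "m \<ge> 2"
  shows "M m n = fact m * (\<Sum>k\<in>compositions m n.
    ennreal (fact n / (\<Prod>i\<in>{1..m}. fact (k i))) * chamber_integral m k 0)"
proof -
  have "M m n = integral\<^sup>N (PiM {1..m} (\<lambda>_. lborel)) (M_integrand m n)"
    by (simp add: M_def M_integrand_def[abs_def])
  also have "\<dots> = fact m * (\<integral>\<^sup>+x. M_integrand m n x * indicator {x. mono_on {1..m} x} x \<partial>PiM {1..m} (\<lambda>_. lborel))"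
    by (intro nn_integral_PiM_symmetric measurable_M_integrand M_integrand_permute)
  also have "(\<integral>\<^sup>+x. M_integrand m n x * indicator {x. mono_on {1..m} x} x \<partial>PiM {1..m} (\<lambda>_. lborel)) =
      (\<integral>\<^sup>+x. (\<Sum>k\<in>compositions m n. ennreal (fact n / (\<Prod>i\<in>{1..m}. fact (k i))) *
        (ennreal ((\<Prod>i\<in>{1..m}. (- ln (x i)) ^ k i / x i) * (- ln (x m)) ^ 0) * indicator (chamber m) x))
      \<partial>PiM {1..m} (\<lambda>_. lborel))"
  proof (rule nn_integral_cong)
    fix x :: "nat \<Rightarrow> real"
    define c :: "(nat \<Rightarrow> nat) \<Rightarrow> real" where "c k = fact n / (\<Prod>i\<in>{1..m}. fact (k i))" for k :: "nat \<Rightarrow> nat"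
    have c: "0 \<le> c k" for k
      by (simp add: c_def prod_nonneg)
    show "M_integrand m n x * indicator {x. mono_on {1..m} x} x =
      (\<Sum>k\<in>compositions m n. ennreal (fact n / (\<Prod>i\<in>{1..m}. fact (k i))) *
        (ennreal ((\<Prod>i\<in>{1..m}. (- ln (x i)) ^ k i / x i) * (- ln (x m)) ^ 0) * indicator (chamber m) x))"
      unfolding c_def[symmetric]
    proof (cases "x \<in> chamber m")
      case True
      note pos = prod_ln_power_nonneg[OF True assms]
      have "M_integrand m n x * indicator {x. mono_on {1..m} x} x =
          ennreal (\<Sum>k\<in>compositions m n. c k * (\<Prod>i\<in>{1..m}. (- ln (x i)) ^ k i / x i))"
        using True chamberD(1)[OF True assms]
        unfolding chamber_eq_W_Int_mono[OF assms] M_integrand_def c_def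
        by (subst ln_prod_power_div_prod) (auto simp: indicator_def)
      also have "\<dots> = (\<Sum>k\<in>compositions m n. ennreal (c k * (\<Prod>i\<in>{1..m}. (- ln (x i)) ^ k i / x i)))"
        using c pos by (intro sum_ennreal[symmetric]) (simp add: mult_nonneg_nonneg)
      finally show "M_integrand m n x * indicator {x. mono_on {1..m} x} x =
          (\<Sum>k\<in>compositions m n. ennreal (c k) *
        (ennreal ((\<Prod>i\<in>{1..m}. (- ln (x i)) ^ k i / x i) * (- ln (x m)) ^ 0) * indicator (chamber m) x))"
        using True c by (simp add: ennreal_mult')
    next
      case False
      then show "M_integrand m n x * indicator {x. mono_on {1..m} x} x =
          (\<Sum>k\<in>compositions m n. ennreal (c k) *
        (ennreal ((\<Prod>i\<in>{1..m}. (- ln (x i)) ^ k i / x i) * (- ln (x m)) ^ 0) * indicator (chamber m) x))"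
        unfolding chamber_eq_W_Int_mono[OF assms] by (auto simp: M_integrand_def indicator_def)
    qed
  qed
  also have "\<dots> = (\<Sum>k\<in>compositions m n. ennreal (fact n / (\<Prod>i\<in>{1..m}. fact (k i))) * chamber_integral m k 0)"
    using measurable_chamber_integrand[OF assms]
    by (simp only: chamber_integral_def nn_integral_sum nn_integral_cmult borel_measurable_times_ennreal borel_measurable_const)
  finally show ?thesis .
qed

text \<open>The factor \<open>fact (k 1)\<close> from the two smallest variables cancels against the
  multinomial coefficient, leaving just the factorials in \<open>Acoef\<close>.\<close>

lemma M_eq:
  assumes "m \<ge> 2"
  shows "M m n = ennreal (fact m * fact n * (\<Sum>k\<in>compositions m n.
    Acoef m k * wedge_value ((\<Sum>i\<in>{2..m}. k i) + m - 2) (k 1)))"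
proof -
  define S where "S k = (\<Sum>i\<in>{2..m}. k i) + m - 2" for k :: "nat \<Rightarrow> nat"
  have Acoef_nonneg: "0 \<le> Acoef m k" for k
    unfolding Acoef_def
    by (intro divide_nonneg_nonneg prod_nonneg of_nat_0_le_iff fact_ge_zero zero_le_one)
  have "ennreal (fact n / (\<Prod>i\<in>{1..m}. fact (k i))) * chamber_integral m k 0 =
      ennreal (fact n * (Acoef m k * wedge_value (S k) (k 1)))" for k
  proof -
    have ins: "{1..m} = insert 1 {2..m}"
      using assms by auto
    have "(\<Prod>i\<in>{1..m}. fact (k i) :: real) = fact (k 1) * (\<Prod>i\<in>{2..m}. fact (k i))"
      unfolding ins by (subst prod.insert) auto
    moreover have "(\<Sum>i\<in>{2..m}. k i) + (m - 2) + 0 = S k"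
      using assms by (simp add: S_def)
    ultimately have "fact n / (\<Prod>i\<in>{1..m}. fact (k i)) *
        ((\<Prod>j\<in>{3..m}. 1 / real ((\<Sum>i\<in>{j..m}. k i) + (m - j + 1) + 0)) *
         fact (k 1) * wedge_value ((\<Sum>i\<in>{2..m}. k i) + (m - 2) + 0) (k 1)) =
        fact n * (Acoef m k * wedge_value (S k) (k 1))"
      by (simp add: Acoef_def prod_dividef field_simps)
    moreover have nonneg: "0 \<le> fact n / (\<Prod>i\<in>{1..m}. fact (k i) :: real)"
      by (intro divide_nonneg_nonneg prod_nonneg) auto
    ultimately show ?thesis
      by (simp only: chamber_integral_eq[OF assms] ennreal_mult'[OF nonneg, symmetric])
  qed
  then have "M m n = fact m * (\<Sum>k\<in>compositions m n. ennreal (fact n * (Acoef m k * wedge_value (S k) (k 1))))"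
    by (simp add: M_eq_sum_chamber_integral[OF assms])
  \<comment> \<open>Moving the sum inside \<open>ennreal\<close> requires nonnegative summands,
    hence \<open>wedge_value_nonneg\<close>.\<close>
  also have "(\<Sum>k\<in>compositions m n. ennreal (fact n * (Acoef m k * wedge_value (S k) (k 1)))) =
      ennreal (\<Sum>k\<in>compositions m n. fact n * (Acoef m k * wedge_value (S k) (k 1)))"
    using Acoef_nonneg wedge_value_nonneg by (intro sum_ennreal) simp
  also have "(fact m :: ennreal) = ennreal (fact m)"
    by (metis ennreal_of_nat_eq_real_of_nat of_nat_fact)
  finally show ?thesis
    by (simp add: S_def sum_distrib_left mult.assoc flip: ennreal_mult')
qed

theorem theorem8:
  fixes m n :: nat
  assumes "m \<ge> 2"
  shows "M m n = ennreal (fact m * fact n *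
      (\<Sum>k\<in>{k \<in> {1..m} \<rightarrow>\<^sub>E {0..n}. (\<Sum>i\<in>{1..m}. k i) = n}.
         (let S = (\<Sum>i\<in>{2..m}. k i) + m - 2 in
          Acoef m k *
          (fact S * mzv ((S + 2) # replicate (k 1) 1)
           - ln 2 ^ (m + n) / (fact (k 1 + 1) * real (m + n))
           - fact S * (\<Sum>p = 0..S. ln 2 ^ p / fact p *
                         mpl ((S + 2 - p) # replicate (k 1) 1) (1/2))))))
    \<and> (\<exists>r. M m n = ennreal r \<and>
         r \<in> rat_poly_ring ({ln 2}
              \<union> {mzv (a # replicate (m + n - a) 1) | a. m \<le> a \<and> a \<le> m + n}
              \<union> {mpl (b # replicate c 1) (1/2) | b c. 2 \<le> b \<and> c \<le> n \<and> b + c \<le> m + n}))"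
proof (rule conjI)
  define S where "S k = (\<Sum>i\<in>{2..m}. k i) + m - 2" for k :: "nat \<Rightarrow> nat"
  \<comment> \<open>The weight is constant over all compositions, which turns the exponents of
    \<open>wedge_value\<close> into \<open>m + n\<close> and bounds the weights of the special
    values.\<close>
  have weight: "S k + k 1 + 2 = m + n" "k 1 \<le> n" if "k \<in> compositions m n" for k
  proof -
    have ins: "{1..m} = insert 1 {2..m}"
      using assms by auto
    have "k 1 + (\<Sum>i\<in>{2..m}. k i) = n"
      using that unfolding compositions_def ins by simp
    then show "S k + k 1 + 2 = m + n" "k 1 \<le> n"
      using assms by (simp_all add: S_def)
  qed
  have "wedge_value (S k) (k 1) = fact (S k) * mzv ((S k + 2) # replicate (k 1) 1)
           - ln 2 ^ (m + n) / (fact (k 1 + 1) * real (m + n))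
           - fact (S k) * (\<Sum>p = 0..S k. ln 2 ^ p / fact p *
                         mpl ((S k + 2 - p) # replicate (k 1) 1) (1/2))"
    if "k \<in> compositions m n" for k
    unfolding wedge_value_def weight(1)[OF that] ..
  then show "M m n = ennreal (fact m * fact n *
      (\<Sum>k\<in>{k \<in> {1..m} \<rightarrow>\<^sub>E {0..n}. (\<Sum>i\<in>{1..m}. k i) = n}.
         (let S = (\<Sum>i\<in>{2..m}. k i) + m - 2 in
          Acoef m k *
          (fact S * mzv ((S + 2) # replicate (k 1) 1)
           - ln 2 ^ (m + n) / (fact (k 1 + 1) * real (m + n))
           - fact S * (\<Sum>p = 0..S. ln 2 ^ p / fact p *
                         mpl ((S + 2 - p) # replicate (k 1) 1) (1/2))))))"
    unfolding M_eq[OF assms] compositions_def[symmetric] Let_def S_def[symmetric]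
    by (intro arg_cong[where f = ennreal] arg_cong2[where f = "(*)"] sum.cong refl)
  define V where "V = {ln 2}
              \<union> {mzv (a # replicate (m + n - a) 1) | a. m \<le> a \<and> a \<le> m + n}
              \<union> {mpl (b # replicate c 1) (1/2) | b c. 2 \<le> b \<and> c \<le> n \<and> b + c \<le> m + n}"
  have "wedge_value (S k) (k 1) \<in> rat_poly_ring V" if "k \<in> compositions m n" for k
  proof (rule wedge_value_in_rat_poly_ring)
    note w = weight[OF that]
    show "ln 2 \<in> rat_poly_ring V"
      by (rule rat_poly_ring.gen) (simp add: V_def)
    \<comment> \<open>The first index of the zeta value is \<open>a = S k + 2\<close>; constant
      weight then fixes the number of ones.\<close>
    have "k 1 = m + n - (S k + 2)" "m \<le> S k + 2" "S k + 2 \<le> m + n"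
      using w by auto
    then have "\<exists>a. mzv ((S k + 2) # replicate (k 1) 1) = mzv (a # replicate (m + n - a) 1) \<and> m \<le> a \<and> a \<le> m + n"
      by metis
    then show "mzv ((S k + 2) # replicate (k 1) 1) \<in> rat_poly_ring V"
      unfolding V_def by (intro rat_poly_ring.gen) blast
    fix p assume "p \<le> S k"
    then have "2 \<le> S k + 2 - p" "S k + 2 - p + k 1 \<le> m + n"
      using w by auto
    with w(2) show "mpl ((S k + 2 - p) # replicate (k 1) 1) (1/2) \<in> rat_poly_ring V"
      unfolding V_def by (intro rat_poly_ring.gen) blast
  qed
  then have "fact m * fact n * (\<Sum>k\<in>compositions m n. Acoef m k * wedge_value (S k) (k 1)) \<in> rat_poly_ring V"
    by (intro rat_poly_ring.mult rat_poly_ring_sum rat_poly_ring_Rats[OF Acoef_in_Rats]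
        rat_poly_ring_Rats[OF fact_in_Rats])
  then show "\<exists>r. M m n = ennreal r \<and> r \<in> rat_poly_ring ({ln 2}
              \<union> {mzv (a # replicate (m + n - a) 1) | a. m \<le> a \<and> a \<le> m + n}
              \<union> {mpl (b # replicate c 1) (1/2) | b c. 2 \<le> b \<and> c \<le> n \<and> b + c \<le> m + n})"
    using M_eq[OF assms, of n] unfolding V_def[symmetric] S_def by blast
qed

end
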